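(* Let $p\in\mathbb{C}[z_1,z_2]$ be semi-stable of bidegree $(n,m)$. Let $g\in\mathbb{C}[z_2]$ be the $\mathbb{T}$-factor of $\det E_1(z_2)$ and $h\in\mathbb{C}[z_1]$ the $\mathbb{T}$-factor of $\det E_2(z_1)$. Then $g(z_2)h(z_1)\,\mathcal{I}_p\subset\mathcal{I}_p^\infty$.
   Context: $\mathbb{D}$ is the open unit disk, $\mathbb{T}$ the unit circle, $\sigma$ normalized Lebesgue measure on $\mathbb{T}^2$. For $p$ of bidegree $(n,m)$, $\tilde p(z)=z_1^nz_2^m\overline{p(1/\bar z_1,1/\bar z_2)}$; $p$ is semi-stable if it has no zeros in $\mathbb{D}^2$ and $p,\tilde p$ have no common factor. $\mathcal{I}_p=\{q\in\mathbb{C}[z_1,z_2]:q/p\in L^2(\mathbb{T}^2)\}$ and $\mathcal{I}_p^\infty=\{q\in\mathbb{C}[z_1,z_2]:q/p\in L^\infty(\mathbb{T}^2)\}$. In the Hilbert space $L^2(\frac{1}{|p|^2}d\sigma)$ let $\mathcal{P}_{j,k}$ be the polynomials of bidegree at most $(j,k)$ in this space, and $\mathcal{E}_1=\mathcal{P}_{n-1,m}\ominus z_2\mathcal{P}_{n-1,m-1}$ (dimension $n$), $\mathcal{E}_2=\mathcal{P}_{n,m-1}\ominus z_1\mathcal{P}_{n-1,m-1}$ (dimension $m$). Let $\vec E_1\in\mathbb{C}^n[z_1,z_2]$, $\vec E_2\in\mathbb{C}^m[z_1,z_2]$ be column vector polynomials whose entries form orthonormal bases of $\mathcal{E}_1,\mathcal{E}_2$,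 and write $\vec E_1(z)=E_1(z_2)\Lambda_n(z_1)$, $\vec E_2(z)=E_2(z_1)\Lambda_m(z_2)$ with matrix polynomials $E_1\in\mathbb{C}^{n\times n}[z_2]$, $E_2\in\mathbb{C}^{m\times m}[z_1]$, where $\Lambda_N(x)=(1,x,\dots,x^{N-1})^t$. If a one-variable polynomial factors as $g_1g_2$ with $g_1$ having no zeros on $\mathbb{T}$ and $g_2$ having all its zeros on $\mathbb{T}$, then $g_2$ (unique up to a constant) is its $\mathbb{T}$-factor. *)

theory Defs
  imports "HOL-Analysis.Analysis" "HOL-Computational_Algebra.Polynomial_Factorial"
begin

text \<open>Bivariate polynomials in z1, z2 are represented as complex poly poly:
  the outer variable is z2, the coefficients (of z2^k) are polynomials in z1.\<close>

definition eval2 :: "complex poly poly \<Rightarrow> complex \<Rightarrow> complex \<Rightarrow> complex" where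
  "eval2 P z1 z2 = poly (map_poly (\<lambda>c. poly c z1) P) z2"

definition deg1 :: "complex poly poly \<Rightarrow> nat" where
  "deg1 P = (MAX k\<in>{..degree P}. degree (coeff P k))"

definition coeff2 :: "complex poly poly \<Rightarrow> nat \<Rightarrow> nat \<Rightarrow> complex" where
  "coeff2 P j k = coeff (coeff P k) j"

text \<open>tilde p = z1^n z2^m conj(p(1/conj z1, 1/conj z2)) for p of bidegree (n,m):
  coefficient at (j,k) is conj of the coefficient of p at (n-j, m-k).\<close>
definition tilde :: "complex poly poly \<Rightarrow> complex poly poly" where
  "tilde P = (\<Sum>k\<le>degree P. monom (\<Sum>j\<le>deg1 P. monom (cnj (coeff2 P (deg1 P - j) (degree P - k))) j) k)"

definition semi_stable :: "complex poly poly \<Rightarrow> bool" where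
  "semi_stable P \<longleftrightarrow> (\<forall>z1 z2. cmod z1 < 1 \<longrightarrow> cmod z2 < 1 \<longrightarrow> eval2 P z1 z2 \<noteq> 0)
      \<and> coprime P (tilde P)"

text \<open>T^2 parametrised by [0,2pi]^2; sigma = Lebesgue measure/(4 pi^2)\<close>
definition torus :: "(real \<times> real) measure" where
  "torus = lebesgue_on ({0..2*pi} \<times> {0..2*pi})"

definition L2_torus :: "(real \<times> real \<Rightarrow> complex) \<Rightarrow> bool" where
  "L2_torus F \<longleftrightarrow> F \<in> borel_measurable torus \<and> integrable torus (\<lambda>x. (cmod (F x))^2)"

definition Linf_torus :: "(real \<times> real \<Rightarrow> complex) \<Rightarrow> bool" where
  "Linf_torus F \<longleftrightarrow> F \<in> borel_measurable torus \<and> (\<exists>C. AE x in torus. cmod (F x) \<le> C)"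

definition quot_torus :: "complex poly poly \<Rightarrow> complex poly poly \<Rightarrow> real \<times> real \<Rightarrow> complex" where
  "quot_torus Q P = (\<lambda>(s,t). eval2 Q (cis s) (cis t) / eval2 P (cis s) (cis t))"

definition Ip :: "complex poly poly \<Rightarrow> complex poly poly set" where
  "Ip P = {Q. L2_torus (quot_torus Q P)}"

definition Ip_inf :: "complex poly poly \<Rightarrow> complex poly poly set" where
  "Ip_inf P = {Q. Linf_torus (quot_torus Q P)}"

definition wip :: "complex poly poly \<Rightarrow> complex poly poly \<Rightarrow> complex poly poly \<Rightarrow> complex" where
  "wip P F G = (integral\<^sup>L torus (\<lambda>(s,t). eval2 F (cis s) (cis t) * cnj (eval2 G (cis s) (cis t))
        / complex_of_real ((cmod (eval2 P (cis s) (cis t)))^2))) / complex_of_real (4 * pi^2)"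

definition Pset :: "complex poly poly \<Rightarrow> nat \<Rightarrow> nat \<Rightarrow> complex poly poly set" where
  "Pset P j k = {Q \<in> Ip P. deg1 Q \<le> j \<and> degree Q \<le> k}"

definition ocompl :: "complex poly poly \<Rightarrow> complex poly poly set \<Rightarrow> complex poly poly set \<Rightarrow> complex poly poly set" where
  "ocompl P A B = {F \<in> A. \<forall>H\<in>B. wip P F H = 0}"

definition Z1 :: "complex poly poly" where "Z1 = [:[:0,1:]:]"
definition Z2 :: "complex poly poly" where "Z2 = [:0,1:]"

definition E1space :: "complex poly poly \<Rightarrow> complex poly poly set" where
  "E1space P = ocompl P (Pset P (deg1 P - 1) (degree P)) ((\<lambda>Q. Z2 * Q) ` Pset P (deg1 P - 1) (degree P - 1))"

definition E2space :: "complex poly poly \<Rightarrow> complex poly poly set" where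
  "E2space P = ocompl P (Pset P (deg1 P) (degree P - 1)) ((\<lambda>Q. Z1 * Q) ` Pset P (deg1 P - 1) (degree P - 1))"

definition onb :: "complex poly poly \<Rightarrow> complex poly poly set \<Rightarrow> nat \<Rightarrow> (nat \<Rightarrow> complex poly poly) \<Rightarrow> bool" where
  "onb P S N e \<longleftrightarrow> (\<forall>i<N. e i \<in> S)
     \<and> (\<forall>i<N. \<forall>j<N. wip P (e i) (e j) = (if i = j then 1 else 0))
     \<and> (\<forall>F\<in>S. \<exists>c :: nat \<Rightarrow> complex. F = (\<Sum>i<N. [:[:c i:]:] * e i))"

definition detN :: "nat \<Rightarrow> (nat \<Rightarrow> nat \<Rightarrow> 'a::comm_ring_1) \<Rightarrow> 'a" where
  "detN N M = (\<Sum>\<sigma> | \<sigma> permutes {..<N}. of_int (sign \<sigma>) * (\<Prod>i<N. M i (\<sigma> i)))"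

text \<open>E1(z2): vec E1(z) = E1(z2) Lambda_n(z1), entry (i,j) = z2-polynomial of coefficients of z1^j in e i\<close>
definition E1mat :: "(nat \<Rightarrow> complex poly poly) \<Rightarrow> nat \<Rightarrow> nat \<Rightarrow> complex poly" where
  "E1mat e i j = map_poly (\<lambda>c. coeff c j) (e i)"

text \<open>E2(z1): vec E2(z) = E2(z1) Lambda_m(z2), entry (i,k) = coefficient of z2^k in e i\<close>
definition E2mat :: "(nat \<Rightarrow> complex poly poly) \<Rightarrow> nat \<Rightarrow> nat \<Rightarrow> complex poly" where
  "E2mat e i k = coeff (e i) k"

definition T_factor :: "complex poly \<Rightarrow> complex poly \<Rightarrow> bool" where
  "T_factor g f \<longleftrightarrow> (\<exists>g1. f = g1 * g \<and> (\<forall>z. cmod z = 1 \<longrightarrow> poly g1 z \<noteq> 0)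
                          \<and> (\<forall>z. poly g z = 0 \<longrightarrow> cmod z = 1))"

definition in_z1 :: "complex poly \<Rightarrow> complex poly poly" where "in_z1 h = [:h:]"
definition in_z2 :: "complex poly \<Rightarrow> complex poly poly" where "in_z2 g = map_poly (\<lambda>c. [:c:]) g"

end

theory Submission
  imports "Jordan_Normal_Form.Determinant" Defs "HOL-Complex_Analysis.Complex_Analysis"
    "HOL-Computational_Algebra.Fundamental_Theorem_Algebra" "HOL-Computational_Algebra.Field_as_Ring"
begin

text \<open>Fix $w = z_1$ on the circle and consider $N_q(w) = \int |q(w,z)|^2 / |p(w,z)|^2 \, |dz|$.
  Because $p$ and $\tilde p$ are coprime, $N_q$ agrees with a rational function of $w$ off a finite
  set; if $q \in \mathcal{I}_p$ it is integrable, and an integrable rational function on the circle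
  is bounded.  Applying this to the entries of $\vec E_2$ and expanding $\det E_2(w)$ by cofactors
  shows that $|\det E_2(w)|^2 N_1(w)$ is bounded as well.  On the other hand a one-variable
  estimate, uniform in $w$, gives $|q/p|^2 \le C N_q N_1$ on the circle: if $\rho$ is the distance
  of a point to the nearest zero of $p(w, \cdot)$, then $N_1$ is at least of order $1/\rho$, while
  $\rho\, |q/p|^2$ is at most of order $N_q$.  Hence $\det E_2(z_1)\, q/p$ is bounded on the
  torus, and on the circle $|h|$ is at most a multiple of $|\det E_2|$.\<close>

section \<open>Pointwise bounds for one-variable quotients\<close>

text \<open>The obstacle is a zero of p on the torus: as w approaches its first coordinate, zeros of
  p(w, .) may approach the circle and N_1(w) may blow up. The one-variable estimate confines this
  blow-up to the factor N_1(w), which depends on w alone and not on q, so a multiplier in z_1 can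
  compensate it. The determinant qualifies because it is constant in z_2 and is a combination of the
  entries of the vector E_2 with coefficients in C[z_1], which are bounded on the circle.
  Rationality comes from Fourier coefficients: those of 1/p(w, .) vanish on one side, since p(w, .)
  has no zeros in the closed disc for all but finitely many w, and the others satisfy a linear
  recursion over C[z_1]. The slice estimates are proved off finitely many w. The resulting
  inequality is therefore kept free of denominators, so that continuity in w extends it to the whole
  circle.\<close>

lemma poly_altdef_le:
  fixes P :: "'a::comm_semiring_1 poly"
  assumes "degree P \<le> d"
  shows "poly P x = (\<Sum>k\<le>d. coeff P k * x ^ k)"
  unfolding poly_altdef using assms
  by (intro sum.mono_neutral_left) (auto simp: coeff_eq_0)

text \<open>A linear factor at most doubles when its argument moves by no more than the distance to
  its root: |\<zeta> - a| \<le> |\<zeta> - z0| + |z0 - a| \<le> 2 |z0 - a|. The induction strips off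
  one root at a time.\<close>

lemma poly_doubling:
  fixes P :: "complex poly"
  assumes "\<And>a. poly P a = 0 \<Longrightarrow> \<rho> \<le> cmod (z0 - a)" and "cmod (\<zeta> - z0) \<le> \<rho>"
  shows "cmod (poly P \<zeta>) \<le> 2 ^ degree P * cmod (poly P z0)"
  using assms(1)
proof (induction "degree P" arbitrary: P)
  case 0
  then obtain c where "P = [:c:]" by (metis degree_eq_zeroE)
  then show ?case by simp
next
  case (Suc d)
  then have "\<not> constant (poly P)" by (metis constant_degree nat.distinct(1))
  then obtain a where a: "poly P a = 0" using fundamental_theorem_of_algebra by blast
  then obtain R where R: "P = [:-a, 1:] * R" by (metis dvdE poly_eq_0_iff_dvd)
  have "R \<noteq> 0" using Suc(2) R by auto
  then have deg: "degree P = Suc (degree R)" unfolding R by (subst degree_mult_eq) auto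
  have IH: "cmod (poly R \<zeta>) \<le> 2 ^ degree R * cmod (poly R z0)"
  proof (rule Suc(1))
    show "d = degree R" using Suc(2) deg by simp
    show "\<rho> \<le> cmod (z0 - b)" if "poly R b = 0" for b
      using that Suc(3)[of b] unfolding R by simp
  qed
  have "cmod (\<zeta> - a) \<le> cmod (\<zeta> - z0) + cmod (z0 - a)"
    using norm_triangle_ineq[of "\<zeta> - z0" "z0 - a"] by simp
  also have "\<dots> \<le> 2 * cmod (z0 - a)" using Suc(3)[OF a] assms(2) by simp
  finally have "cmod (\<zeta> - a) * cmod (poly R \<zeta>) \<le> (2 * cmod (z0 - a)) * (2 ^ degree R * cmod (poly R z0))"
    using IH by (intro mult_mono) auto
  moreover have "poly P x = (x - a) * poly R x" for x unfolding R by (simp add: algebra_simps)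
  ultimately show ?case unfolding deg by (simp add: norm_mult mult_ac)
qed

text \<open>Multiplying by a monic linear factor with unimodular root at most doubles the largest
  coefficient.\<close>

lemma sum_cmod_coeff_prod_linear:
  fixes f :: "'a \<Rightarrow> complex"
  assumes "finite A" "\<And>a. a \<in> A \<Longrightarrow> cmod (f a) = 1"
  shows "cmod (coeff (\<Prod>a\<in>A. [:- f a, 1:]) k) \<le> 2 ^ card A"
  using assms
proof (induction A arbitrary: k rule: finite_induct)
  case empty
  then show ?case by (auto simp: coeff_1)
next
  case (insert a A)
  let ?Q = "\<Prod>a\<in>A. [:- f a, 1:]"
  have "coeff (\<Prod>a\<in>insert a A. [:- f a, 1:]) k = - f a * coeff ?Q k + coeff (pCons 0 ?Q) k"
    using insert by simp
  also have "cmod \<dots> \<le> cmod (coeff ?Q k) + cmod (coeff (pCons 0 ?Q) k)"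
    using norm_triangle_ineq[of "- f a * coeff ?Q k" "coeff (pCons 0 ?Q) k"] insert(4)[of a]
    by (simp add: norm_mult)
  also have "\<dots> \<le> 2 ^ card A + 2 ^ card A"
    using insert by (intro add_mono) (auto simp: coeff_pCons split: nat.splits)
  finally show ?case using insert by simp
qed

text \<open>Writing $S$ for the dilation $q(z) \mapsto q(\omega z)$, the operator
  $\prod_{l \le N} (S - \omega^l)$ annihilates all polynomials of degree at most $N$.\<close>
lemma cmod_poly_le_sum_rotations:
  fixes Q :: "complex poly"
  assumes deg: "degree Q \<le> N" and om: "cmod \<omega> = 1"
  shows "cmod (poly Q z) \<le> 2 ^ (N+1) * (\<Sum>k=1..N+1. cmod (poly Q (\<omega> ^ k * z)))"
proof -
  define P where "P = (\<Prod>l\<le>N. [:- (\<omega> ^ l), 1:])"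
  have bound: "cmod (coeff P k) \<le> 2 ^ (N+1)" for k
    unfolding P_def using sum_cmod_coeff_prod_linear[of "{..N}" "\<lambda>l. \<omega> ^ l" k] om
    by (simp add: norm_power)
  have degP: "degree P = N + 1" unfolding P_def by (subst degree_prod_sum_eq) auto
  \<comment> \<open>The product of the roots is unimodular, so the k = 0 term can be solved for.
    Unlike in Lagrange interpolation, the constant does not degenerate when the rotated points crowd
    together as \<omega> tends to 1.\<close>
  have "poly P 0 = (\<Prod>l\<le>N. - (\<omega> ^ l))" unfolding P_def by (simp add: poly_prod)
  then have P0: "cmod (coeff P 0) = 1" using om
    by (simp add: poly_0_coeff_0 prod_norm[symmetric] norm_power)
  have root: "poly P (\<omega> ^ l) = 0" if "l \<le> N" for l
    unfolding P_def poly_prod using that by (intro prod_zero) auto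
  have "(\<Sum>k\<le>N+1. coeff P k * poly Q (\<omega> ^ k * z))
      = (\<Sum>k\<le>N+1. \<Sum>l\<le>N. coeff P k * (coeff Q l * (\<omega> ^ k * z) ^ l))"
    using deg by (intro sum.cong refl) (simp add: poly_altdef_le sum_distrib_left)
  also have "\<dots> = (\<Sum>l\<le>N. coeff Q l * z ^ l * (\<Sum>k\<le>N+1. coeff P k * (\<omega> ^ l) ^ k))"
    by (subst sum.swap) (simp del: sum.atMost_Suc add: sum_distrib_left mult_ac power_mult_distrib power_mult[symmetric])
  also have "\<dots> = (\<Sum>l\<le>N. coeff Q l * z ^ l * poly P (\<omega> ^ l))"
    using degP by (simp add: poly_altdef)
  also have "\<dots> = 0" using root by simp
  finally have "0 = coeff P 0 * poly Q z + (\<Sum>k=1..N+1. coeff P k * poly Q (\<omega> ^ k * z))"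
    by (simp add: atMost_atLeast0 sum.atLeast_Suc_atMost add.assoc)
  then have "coeff P 0 * poly Q z = - (\<Sum>k=1..N+1. coeff P k * poly Q (\<omega> ^ k * z))"
    by (rule eq_neg_iff_add_eq_0[THEN iffD2, OF sym])
  then have "cmod (poly Q z) = cmod (\<Sum>k=1..N+1. coeff P k * poly Q (\<omega> ^ k * z))"
    by (metis P0 norm_mult norm_minus_cancel mult_1)
  also have "\<dots> \<le> (\<Sum>k=1..N+1. 2 ^ (N+1) * cmod (poly Q (\<omega> ^ k * z)))"
    by (rule sum_norm_le) (use bound in \<open>simp add: norm_mult mult_right_mono\<close>)
  finally show ?thesis by (simp only: sum_distrib_left)
qed

section \<open>Sup and Lipschitz bounds on the disc of radius 2\<close>

lemma norm_diff_power_le: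
  fixes x y :: complex
  assumes "cmod x \<le> 2" "cmod y \<le> 2"
  shows "cmod (x ^ k - y ^ k) \<le> real k * 2 ^ k * cmod (x - y)"
proof (induction k)
  case (Suc k)
  have "x ^ Suc k - y ^ Suc k = x * (x ^ k - y ^ k) + (x - y) * y ^ k" by (simp add: algebra_simps)
  also have "cmod \<dots> \<le> cmod x * cmod (x ^ k - y ^ k) + cmod (x - y) * cmod y ^ k"
    by (metis norm_mult norm_power norm_triangle_ineq)
  also have "\<dots> \<le> 2 * (real k * 2 ^ k * cmod (x - y)) + cmod (x - y) * 2 ^ k"
    using assms Suc by (intro add_mono mult_mono power_mono) auto
  also have "\<dots> \<le> real (Suc k) * 2 ^ Suc k * cmod (x - y)"
    using mult_nonneg_nonneg[of "2 ^ k" "cmod (x - y)"] by (simp add: algebra_simps)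
  finally show ?case .
qed simp

text \<open>One constant serving both as sup bound and as Lipschitz constant on |x| \<le> 2. The
  range of summation is the fixed \<open>d\<close>, not the degree, which may drop for special
  slices; the bound thus varies continuously with the coefficients.\<close>

definition lip_bound :: "nat \<Rightarrow> complex poly \<Rightarrow> real" where
  "lip_bound d P = (\<Sum>k\<le>d. cmod (coeff P k) * (real k + 1) * 2 ^ k)"

lemma cmod_poly_le_lip_bound:
  assumes "degree P \<le> d" "cmod x \<le> 2"
  shows "cmod (poly P x) \<le> lip_bound d P"
proof -
  have "cmod (poly P x) = cmod (\<Sum>k\<le>d. coeff P k * x ^ k)"
    using assms by (simp add: poly_altdef_le)
  also have "\<dots> \<le> (\<Sum>k\<le>d. cmod (coeff P k) * 2 ^ k)"
    using assms by (intro sum_norm_le) (auto simp: norm_mult norm_power intro!: mult_left_mono power_mono)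
  also have "\<dots> \<le> lip_bound d P"
    unfolding lip_bound_def by (intro sum_mono mult_right_mono) (auto simp: mult_le_cancel_left1)
  finally show ?thesis .
qed

lemma cmod_poly_diff_le_lip_bound:
  assumes "degree P \<le> d" "cmod x \<le> 2" "cmod y \<le> 2"
  shows "cmod (poly P x - poly P y) \<le> lip_bound d P * cmod (x - y)"
proof -
  have "cmod (poly P x - poly P y) = cmod (\<Sum>k\<le>d. coeff P k * (x ^ k - y ^ k))"
    using assms by (simp add: poly_altdef_le algebra_simps sum_subtractf)
  also have "\<dots> \<le> (\<Sum>k\<le>d. cmod (coeff P k) * ((real k + 1) * 2 ^ k * cmod (x - y)))"
  proof (rule sum_norm_le)
    fix k
    have "real k * 2 ^ k * cmod (x - y) \<le> (real k + 1) * 2 ^ k * cmod (x - y)"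
      by (intro mult_right_mono) auto
    with norm_diff_power_le[OF assms(2,3), of k]
    have "cmod (x ^ k - y ^ k) \<le> (real k + 1) * 2 ^ k * cmod (x - y)" by (rule order_trans)
    then show "cmod (coeff P k * (x ^ k - y ^ k)) \<le> cmod (coeff P k) * ((real k + 1) * 2 ^ k * cmod (x - y))"
      unfolding norm_mult by (intro mult_left_mono) auto
  qed
  also have "\<dots> = lip_bound d P * cmod (x - y)"
    unfolding lip_bound_def by (simp add: sum_distrib_left sum_distrib_right mult_ac)
  finally show ?thesis .
qed

lemma integral_affine_le:
  fixes g :: "real \<Rightarrow> real"
  assumes g: "continuous_on UNIV g" "\<And>x. 0 \<le> g x" and "c \<noteq> 0" "0 \<le> \<eta>"
    and "t0 \<in> {A..B}" "t0 + c * \<eta> \<in> {A..B}"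
  shows "\<bar>c\<bar> * integral {0..\<eta>} (\<lambda>s. g (t0 + c * s)) \<le> integral {A..B} g"
proof -
  define l u where "l = min t0 (t0 + c * \<eta>)" and "u = max t0 (t0 + c * \<eta>)"
  have lu: "l \<le> u" "{l..u} \<subseteq> {A..B}" using assms unfolding l_def u_def by auto
  have cont: "continuous_on S g" for S using g(1) continuous_on_subset by blast
  have int: "g integrable_on {a..b}" for a b by (rule integrable_continuous_interval[OF cont])
  have "((\<lambda>x. g (c *\<^sub>R x + t0)) has_integral (1 / (\<bar>c\<bar> ^ DIM(real))) *\<^sub>R integral {l..u} g)
      ((\<lambda>x. (1 / c) *\<^sub>R x + - ((1 / c) *\<^sub>R t0)) ` cbox l u)"
    using int[of l u] assms by (intro has_integral_affinity) (auto simp: integrable_integral)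
  moreover have "(\<lambda>x. (1 / c) *\<^sub>R x + - ((1 / c) *\<^sub>R t0)) ` cbox l u = {0..\<eta>}"
  proof -
    have e: "(1 / c) * t0 + - ((1 / c) * t0) = 0" "(1 / c) * (t0 + c * \<eta>) + - ((1 / c) * t0) = \<eta>"
      using assms(3) by (simp_all add: distrib_left)
    have lu': "{l..u} \<noteq> {}" using lu(1) by simp
    show ?thesis
    proof (cases "c > 0")
      case True
      then have "l = t0" "u = t0 + c * \<eta>" "0 \<le> 1 / c" using assms(4) unfolding l_def u_def by auto
      then show ?thesis using lu' e
        unfolding cbox_interval real_scaleR_def image_affinity_atLeastAtMost by simp
    next
      case False
      then have c: "c < 0" using assms(3) by simp
      then have "c * \<eta> \<le> 0" using assms(4) by (simp add: mult_le_0_iff)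
      then have "u = t0" "l = t0 + c * \<eta>" "\<not> 0 \<le> 1 / c" using c unfolding l_def u_def by auto
      then show ?thesis using lu' e
        unfolding cbox_interval real_scaleR_def image_affinity_atLeastAtMost by simp
    qed
  qed
  ultimately have "((\<lambda>x. g (t0 + c * x)) has_integral (1 / \<bar>c\<bar>) * integral {l..u} g) {0..\<eta>}"
    by (simp add: add.commute)
  then have "\<bar>c\<bar> * integral {0..\<eta>} (\<lambda>s. g (t0 + c * s)) = integral {l..u} g"
    using assms by (simp add: integral_unique)
  also have "\<dots> \<le> integral {A..B} g"
    by (rule integral_subset_le) (use lu int g in auto)
  finally show ?thesis .
qed


lemma cmod_cis_diff_le: "cmod (cis x - cis y) \<le> \<bar>x - y\<bar>"
proof -
  have "cis x - cis y = cis y * (exp (\<i> * of_real (x - y)) - 1)"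
    by (simp add: cis_conv_exp algebra_simps flip: exp_add)
  then have "cmod (cis x - cis y) = 2 * \<bar>sin ((x - y) / 2)\<bar>"
    using dist_exp_i_1[of "x - y"] by (simp add: norm_mult)
  then show ?thesis using abs_sin_x_le_abs_x[of "(x - y) / 2"] by simp
qed

text \<open>The radius is the distance to the nearest root, capped at 1. If a root \<open>a\<close>
  is nearer than 1, then |P(z0)| = |P(z0) - P(a)| is controlled by the Lipschitz bound; otherwise
  the sup bound suffices. The cap keeps the root in the disc of radius 2 and the later arc
  short.\<close>

lemma poly_zero_free_radius:
  fixes P :: "complex poly"
  assumes deg: "degree P \<le> d" and z0: "cmod z0 = 1" "poly P z0 \<noteq> 0"
  obtains \<rho> where "0 < \<rho>" "\<rho> \<le> 1" "cmod (poly P z0) \<le> lip_bound d P * \<rho>"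
    "\<And>a. poly P a = 0 \<Longrightarrow> \<rho> \<le> cmod (z0 - a)"
proof (cases "\<exists>a. poly P a = 0 \<and> cmod (z0 - a) < 1")
  case False
  then show ?thesis using that[of 1] cmod_poly_le_lip_bound[OF deg, of z0] z0 by force
next
  case True
  let ?A = "{a. poly P a = 0}"
  have fin: "finite ?A" using z0 by (intro poly_roots_finite) auto
  have ne: "?A \<noteq> {}" using True by auto
  define \<rho> where "\<rho> = Min ((\<lambda>a. cmod (z0 - a)) ` ?A)"
  have "\<rho> \<in> (\<lambda>a. cmod (z0 - a)) ` ?A" unfolding \<rho>_def using fin ne by (intro Min_in) auto
  then obtain a where a: "poly P a = 0" "\<rho> = cmod (z0 - a)" by auto
  have le: "\<rho> \<le> cmod (z0 - b)" if "poly P b = 0" for b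
    unfolding \<rho>_def using that fin by (intro Min_le) auto
  have "\<rho> < 1" using True le by (meson le_less_trans)
  have "cmod a \<le> 2" using norm_triangle_ineq2[of a z0] a \<open>\<rho> < 1\<close> z0 by (simp add: norm_minus_commute)
  then have "cmod (poly P z0 - poly P a) \<le> lip_bound d P * cmod (z0 - a)"
    using z0 by (intro cmod_poly_diff_le_lip_bound deg) auto
  moreover have "0 < \<rho>" using a z0 by auto
  ultimately show ?thesis using that[of \<rho>] a le \<open>\<rho> < 1\<close> by auto
qed

text \<open>Not normalised: the circle has mass 2 pi. The integral is 0 by convention if the
  quotient is not integrable, so lower bounds are meaningful only where \<open>P\<close> has no
  zeros on the circle.\<close>

definition circ_norm :: "complex poly \<Rightarrow> complex poly \<Rightarrow> real" where
  "circ_norm Q P = integral {0..2*pi} (\<lambda>t. (cmod (poly Q (cis t)))\<^sup>2 / (cmod (poly P (cis t)))\<^sup>2)"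

lemma circ_norm_nonneg: "0 \<le> circ_norm Q P"
  unfolding circ_norm_def by (cases "(\<lambda>t. (cmod (poly Q (cis t)))\<^sup>2 / (cmod (poly P (cis t)))\<^sup>2) integrable_on {0..2*pi}")
   (auto intro!: integral_nonneg simp: not_integrable_integral)

lemma continuous_on_circ_norm_integrand:
  assumes "\<And>t. poly P (cis t) \<noteq> 0"
  shows "continuous_on S (\<lambda>t. (cmod (poly Q (cis t)))\<^sup>2 / (cmod (poly P (cis t)))\<^sup>2)"
  using assms by (intro continuous_intros) auto

text \<open>On the arc of length $\rho$ issuing from $z_0$, where $\rho$ is the distance to the nearest
  zero of $P$, the denominator $P$ does not exceed a multiple of $|P(z_0)|$, and $|P(z_0)|$
  is itself at most a multiple of $\rho$.\<close>
lemma cmod_poly_le_circ_norms: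
  fixes P Q :: "complex poly"
  assumes deg: "degree P \<le> d" "degree Q \<le> N" and L: "lip_bound d P \<le> L"
    and nz: "\<And>t. poly P (cis t) \<noteq> 0" and t0: "t0 \<in> {0..2*pi}"
  shows "(cmod (poly Q (cis t0)))\<^sup>2
     \<le> 4 ^ (N + 1 + 2 * d) * (real N + 1) ^ 3 * L\<^sup>2 * (circ_norm Q P * circ_norm 1 P) * (cmod (poly P (cis t0)))\<^sup>2"
proof -
  let ?z0 = "cis t0" and ?p = "cmod (poly P (cis t0))"
  obtain \<rho> where rho: "0 < \<rho>" "\<rho> \<le> 1" "?p \<le> lip_bound d P * \<rho>"
    "\<And>a. poly P a = 0 \<Longrightarrow> \<rho> \<le> cmod (?z0 - a)"
    using poly_zero_free_radius[OF deg(1), of ?z0] nz by auto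
  have "?p \<le> L * \<rho>" using rho(1,3) L by (meson mult_right_mono order_trans less_imp_le)
  \<comment> \<open>Direction of the arc, pointing into the longer half of the parameter interval;
    since \<open>\<rho> \<le> 1\<close>, the arc stays inside \<open>{0..2*pi}\<close> and no
    periodicity argument is needed.\<close>
  define \<sigma> :: real where "\<sigma> = (if t0 \<le> pi then 1 else -1)"
  have \<sigma>: "\<bar>\<sigma>\<bar> = 1" unfolding \<sigma>_def by auto
  have arc: "t0 + \<sigma> * x \<in> {0..2*pi}" if "0 \<le> x" "x \<le> \<rho>" for x
    using that t0 rho(2) pi_gt3 unfolding \<sigma>_def by auto
  have P_arc: "cmod (poly P (cis (t0 + \<sigma> * x))) \<le> 2 ^ d * ?p" if "0 \<le> x" "x \<le> \<rho>" for x
  proof -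
    have "cmod (cis (t0 + \<sigma> * x) - ?z0) \<le> \<bar>\<sigma> * x\<bar>" using cmod_cis_diff_le[of "t0 + \<sigma> * x" t0] by simp
    also have "\<dots> \<le> \<rho>" using \<sigma> that by (simp add: abs_mult)
    finally have "cmod (poly P (cis (t0 + \<sigma> * x))) \<le> 2 ^ degree P * ?p"
      using rho(4) by (intro poly_doubling[where \<rho> = \<rho>]) auto
    also have "\<dots> \<le> 2 ^ d * ?p" using deg by (intro mult_right_mono power_increasing) auto
    finally show ?thesis .
  qed
  have p0: "?p > 0" using nz by simp
  have "L * \<rho> > 0" using p0 \<open>?p \<le> L * \<rho>\<close> by linarith
  then have "L > 0" using rho by (simp add: zero_less_mult_iff)

  let ?g1 = "\<lambda>t. (cmod (poly 1 (cis t)))\<^sup>2 / (cmod (poly P (cis t)))\<^sup>2"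
  let ?gQ = "\<lambda>t. (cmod (poly Q (cis t)))\<^sup>2 / (cmod (poly P (cis t)))\<^sup>2"
  \<comment> \<open>On the arc the denominator is at most 2^d * L * \<rho>, so an arc of length
    \<rho> already contributes 1 / (4^d * L^2 * \<rho>) to the norm of 1.\<close>
  have "\<rho> * (1 / (2 ^ d * (L * \<rho>))\<^sup>2) = integral {0..\<rho>} (\<lambda>s. 1 / (2 ^ d * (L * \<rho>))\<^sup>2)"
    using rho by simp
  also have "\<dots> \<le> integral {0..\<rho>} (\<lambda>s. ?g1 (t0 + \<sigma> * s))"
  proof (rule integral_le)
    show "(\<lambda>s. ?g1 (t0 + \<sigma> * s)) integrable_on {0..\<rho>}"
      using nz by (intro integrable_continuous_interval continuous_intros) auto
    fix s assume s: "s \<in> {0..\<rho>}"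
    have "cmod (poly P (cis (t0 + \<sigma> * s))) \<le> 2 ^ d * (L * \<rho>)"
      using P_arc[of s] s \<open>?p \<le> L * \<rho>\<close> by (auto elim!: order_trans)
    then show "1 / (2 ^ d * (L * \<rho>))\<^sup>2 \<le> ?g1 (t0 + \<sigma> * s)"
      using nz \<open>L > 0\<close> rho(1) by (auto intro!: divide_left_mono power_mono)
  qed auto
  also have "\<dots> \<le> circ_norm 1 P"
    using integral_affine_le[where g = ?g1 and c = \<sigma> and \<eta> = \<rho>, OF continuous_on_circ_norm_integrand[OF nz] _ _ _ t0] \<sigma> rho arc[of \<rho>]
    unfolding circ_norm_def by auto
  finally have "1 / \<rho> \<le> 4 ^ d * L\<^sup>2 * circ_norm 1 P"
    using rho \<open>L > 0\<close> by (simp add: field_simps power2_eq_square flip: power_mult_distrib)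
  
  \<comment> \<open>Rotations by k * s with k \<le> N + 1 stay on the arc of length \<rho> exactly
    when s is at most this large.\<close>
  define \<eta> where "\<eta> = \<rho> / (real N + 1)"
  have eta: "\<eta> > 0" using rho unfolding \<eta>_def by simp
  \<comment> \<open>4^(N+1) is the squared constant of the rotation estimate, N + 1 comes from
    Cauchy-Schwarz, and 4^d * |P(z0)|^2 bounds |P|^2 on the arc, which turns |Q|^2 into the
    integrand of the norm.\<close>
  define K where "K = 4 ^ (N + 1 + d) * (real N + 1) * ?p\<^sup>2"
  have K: "K \<ge> 0" unfolding K_def by simp
  have pt: "(cmod (poly Q ?z0))\<^sup>2 \<le> K * (\<Sum>k=1..N+1. ?gQ (t0 + (\<sigma> * real k) * s))"
    if s: "s \<in> {0..\<eta>}" for s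
  proof -
    have om: "cis (\<sigma> * s) ^ k * ?z0 = cis (t0 + \<sigma> * real k * s)" for k
      by (simp only: Complex.DeMoivre cis_mult) (simp add: algebra_simps)
    have "(cmod (poly Q ?z0))\<^sup>2 \<le> (2 ^ (N+1) * (\<Sum>k=1..N+1. cmod (poly Q (cis (\<sigma> * s) ^ k * ?z0))))\<^sup>2"
      by (intro power_mono cmod_poly_le_sum_rotations deg) auto
    also have "\<dots> = 4 ^ (N+1) * (\<Sum>k=1..N+1. cmod (poly Q (cis (t0 + \<sigma> * real k * s))))\<^sup>2"
      unfolding om by (simp only: power_mult_distrib) (simp add: power_mult[symmetric] mult.commute[of _ 2] power_mult)
    also have "\<dots> \<le> 4 ^ (N+1) * ((real N + 1) * (\<Sum>k=1..N+1. (cmod (poly Q (cis (t0 + \<sigma> * real k * s))))\<^sup>2))"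
      using sum_squared_le_sum_of_squares[of "\<lambda>k. cmod (poly Q (cis (t0 + \<sigma> * real k * s)))" "{1..N+1}"]
      by (intro mult_left_mono) (simp_all add: add.commute mult.commute del: sum.cl_ivl_Suc)
    also have "\<dots> \<le> 4 ^ (N+1) * ((real N + 1) * (\<Sum>k=1..N+1. 4 ^ d * ?p\<^sup>2 * ?gQ (t0 + \<sigma> * real k * s)))"
    proof (intro mult_left_mono sum_mono)
      fix k assume k: "k \<in> {1..N+1}"
      have "real k * s \<le> (real N + 1) * \<eta>" using k s by (intro mult_mono) auto
      also have "\<dots> = \<rho>" unfolding \<eta>_def by simp
      finally have "cmod (poly P (cis (t0 + \<sigma> * (real k * s)))) \<le> 2 ^ d * ?p"
        using s by (intro P_arc) auto
      then have "(cmod (poly P (cis (t0 + \<sigma> * real k * s))))\<^sup>2 \<le> (2 ^ d * ?p)\<^sup>2"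
        by (intro power_mono) (auto simp: mult.assoc)
      also have "\<dots> = 4 ^ d * ?p\<^sup>2" by (simp add: power_mult_distrib power_mult[symmetric] mult.commute[of _ 2] power_mult)
      finally have "(cmod (poly P (cis (t0 + \<sigma> * real k * s))))\<^sup>2 * ?gQ (t0 + \<sigma> * real k * s) \<le> 4 ^ d * ?p\<^sup>2 * ?gQ (t0 + \<sigma> * real k * s)"
        by (rule mult_right_mono) auto
      then show "(cmod (poly Q (cis (t0 + \<sigma> * real k * s))))\<^sup>2 \<le> 4 ^ d * ?p\<^sup>2 * ?gQ (t0 + \<sigma> * real k * s)"
        using nz by simp
    qed auto
    also have "\<dots> = K * (\<Sum>k=1..N+1. ?gQ (t0 + \<sigma> * real k * s))"
      unfolding K_def by (simp only: sum_distrib_left[symmetric] power_add mult_ac)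
    finally show ?thesis .
  qed
  have "\<eta> * (cmod (poly Q ?z0))\<^sup>2 = integral {0..\<eta>} (\<lambda>s. (cmod (poly Q ?z0))\<^sup>2)" using eta by simp
  also have "\<dots> \<le> integral {0..\<eta>} (\<lambda>s. K * (\<Sum>k=1..N+1. ?gQ (t0 + (\<sigma> * real k) * s)))"
    using pt nz by (intro integral_le integrable_continuous_interval continuous_intros) auto
  also have "\<dots> = K * (\<Sum>k=1..N+1. integral {0..\<eta>} (\<lambda>s. ?gQ (t0 + (\<sigma> * real k) * s)))"
    unfolding integral_mult_right using nz
    by (subst integral_sum) (auto intro!: integrable_continuous_interval continuous_intros)
  also have "\<dots> \<le> K * (\<Sum>k=1..N+1. circ_norm Q P)"
  proof (intro mult_left_mono sum_mono K)
    fix k assume k: "k \<in> {1..N+1}"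
    let ?I = "integral {0..\<eta>} (\<lambda>s. ?gQ (t0 + (\<sigma> * real k) * s))"
    have "real k * \<eta> \<le> (real N + 1) * \<eta>" using k eta by (intro mult_mono) auto
    also have "\<dots> = \<rho>" unfolding \<eta>_def by simp
    finally have "t0 + (\<sigma> * real k) * \<eta> \<in> {0..2*pi}" using arc[of "real k * \<eta>"] eta by (simp add: mult.assoc)
    then have "\<bar>\<sigma> * real k\<bar> * ?I \<le> circ_norm Q P"
      unfolding circ_norm_def using eta k \<sigma>
      by (intro integral_affine_le continuous_on_circ_norm_integrand nz t0) auto
    moreover have "?I \<ge> 0" using nz
      by (intro integral_nonneg integrable_continuous_interval continuous_intros) auto
    then have "1 * ?I \<le> \<bar>\<sigma> * real k\<bar> * ?I" using k \<sigma> by (intro mult_right_mono) (auto simp: abs_mult)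
    ultimately show "?I \<le> circ_norm Q P" by simp
  qed
  finally have "\<eta> * (cmod (poly Q ?z0))\<^sup>2 \<le> K * (real N + 1) * circ_norm Q P"
    by (simp add: mult_ac add.commute)
  \<comment> \<open>Of the two new factors N + 1, one counts the equal summands and the other comes
    from 1 / \<eta> = (N + 1) / \<rho>.\<close>
  then have "(cmod (poly Q ?z0))\<^sup>2 \<le> (K * (real N + 1)\<^sup>2 * circ_norm Q P) * (1 / \<rho>)"
    using rho unfolding \<eta>_def by (simp add: field_simps power2_eq_square)
  also have "\<dots> \<le> (K * (real N + 1)\<^sup>2 * circ_norm Q P) * (4 ^ d * L\<^sup>2 * circ_norm 1 P)"
    using \<open>1 / \<rho> \<le> _\<close> K circ_norm_nonneg[of Q P] by (intro mult_left_mono) auto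
  also have "\<dots> = 4 ^ (N + 1 + 2 * d) * (real N + 1) ^ 3 * L\<^sup>2 * (circ_norm Q P * circ_norm 1 P) * ?p\<^sup>2"
    unfolding K_def by (simp add: power_add mult_2 mult_2_right power2_eq_square power3_eq_cube mult_ac)
  finally show ?thesis .
qed

section \<open>Slices of semi-stable polynomials\<close>

lemma eval2_0 [simp]: "eval2 0 w z = 0"
  by (simp add: eval2_def)

lemma eval2_pCons: "eval2 (pCons c P) w z = poly c w + z * eval2 P w z"
  by (simp add: eval2_def map_poly_pCons)

lemma eval2_conv_poly_poly: "eval2 P w z = poly (poly P [:z:]) w"
  by (induction P) (simp_all add: eval2_pCons)

lemma eval2_add: "eval2 (P + Q) w z = eval2 P w z + eval2 Q w z"
  and eval2_mult: "eval2 (P * Q) w z = eval2 P w z * eval2 Q w z"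
  by (simp_all add: eval2_conv_poly_poly)

lemma eval2_const [simp]: "eval2 [:c:] w z = poly c w"
  by (simp add: eval2_pCons)

lemma eval2_in_z1: "eval2 (in_z1 c) w z = poly c w"
  by (simp add: in_z1_def)

lemma eval2_in_z2: "eval2 (in_z2 c) w z = poly c z"
  unfolding in_z2_def by (induction c) (simp_all add: map_poly_pCons eval2_pCons)

lemma eval2_altdef:
  assumes "degree P \<le> d"
  shows "eval2 P w z = (\<Sum>k\<le>d. poly (coeff P k) w * z ^ k)"
  by (simp add: eval2_conv_poly_poly poly_altdef_le[OF assms] poly_sum poly_power)

lemma continuous_on_eval2 [continuous_intros]:
  assumes "continuous_on S f" "continuous_on S g"
  shows "continuous_on S (\<lambda>x. eval2 P (f x) (g x))"
  unfolding eval2_altdef[OF order_refl] using assms by (intro continuous_intros)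

lemma degree_coeff_le_deg1: "degree (coeff P k) \<le> deg1 P"
proof (cases "k \<le> degree P")
  case True
  then show ?thesis unfolding deg1_def by (intro Max_ge) auto
qed (simp add: coeff_eq_0)

text \<open>On the torus 1 / cnj z = z, so \<open>tilde P\<close> and \<open>P\<close> have equal
  modulus there; in particular every torus zero of \<open>P\<close> is a common zero of
  both.\<close>

lemma eval2_tilde:
  assumes "cmod w = 1" "cmod z = 1"
  shows "eval2 (tilde P) w z = w ^ deg1 P * z ^ degree P * cnj (eval2 P w z)"
proof -
  let ?n = "deg1 P" and ?m = "degree P"
  let ?c = "\<lambda>j k. cnj (coeff2 P j k)"
  have inv: "u ^ (N - j) = u ^ N * cnj u ^ j" if "cmod u = 1" "j \<le> N" for u N j
  proof -
    have "u * cnj u = 1" using that by (simp add: complex_norm_square[symmetric])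
    then have "u ^ j * cnj u ^ j = 1" by (simp flip: power_mult_distrib)
    then show ?thesis using that
      by (metis le_add_diff_inverse2 mult.assoc mult.right_neutral power_add)
  qed
  have "eval2 (tilde P) w z = (\<Sum>k\<le>?m. (\<Sum>j\<le>?n. ?c (?n - j) (?m - k) * w ^ j) * z ^ k)"
    unfolding tilde_def eval2_conv_poly_poly by (simp add: poly_sum poly_monom poly_power)
  also have "\<dots> = (\<Sum>k\<le>?m. (\<Sum>j\<le>?n. ?c j k * w ^ (?n - j)) * z ^ (?m - k))"
    unfolding atMost_atLeast0
    by (subst (1) sum.atLeastAtMost_rev, subst (2) sum.atLeastAtMost_rev) (auto intro!: sum.cong)
  also have "\<dots> = (\<Sum>k\<le>?m. (\<Sum>j\<le>?n. ?c j k * (w ^ ?n * cnj w ^ j)) * (z ^ ?m * cnj z ^ k))"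
    using inv[OF assms(1)] inv[OF assms(2)] by (intro sum.cong arg_cong2[where f = "(*)"]) auto
  also have "\<dots> = w ^ ?n * z ^ ?m * cnj (\<Sum>k\<le>?m. (\<Sum>j\<le>?n. coeff2 P j k * w ^ j) * z ^ k)"
    by (simp add: sum_distrib_left sum_distrib_right mult_ac)
  also have "(\<Sum>k\<le>?m. (\<Sum>j\<le>?n. coeff2 P j k * w ^ j) * z ^ k) = eval2 P w z"
    unfolding eval2_altdef[OF order_refl] coeff2_def
    by (simp add: poly_altdef_le[OF degree_coeff_le_deg1])
  finally show ?thesis .
qed

text \<open>Take an element D of least degree in the ideal generated by P and Q. Pseudo-division by
  D leaves remainder 0 on every element of the ideal, so by Gauss's lemma the primitive part of D
  divides both P and Q. It is then a unit, and D is constant in the outer variable. This replaces a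
  resultant.\<close>

lemma coprime_imp_bezout_const:
  fixes P Q :: "'a::{factorial_ring_gcd, semiring_Gcd, semiring_gcd_mult_normalize} poly"
  assumes "coprime P Q" "P \<noteq> 0"
  obtains A B R where "R \<noteq> 0" "A * P + B * Q = [:R:]"
proof -
  define I where "I = {D. \<exists>A B. D = A * P + B * Q}"
  have comb: "smult c X + S * Y \<in> I" if XY: "X \<in> I" "Y \<in> I" for c S X Y
  proof -
    obtain A B A' B' where "X = A * P + B * Q" "Y = A' * P + B' * Q"
      using XY unfolding I_def by auto
    then have "smult c X + S * Y = (smult c A + S * A') * P + (smult c B + S * B') * Q"
      by (simp add: algebra_simps smult_add_right)
    then show ?thesis unfolding I_def by blast
  qed
  have "P = 1 * P + 0 * Q" "Q = 0 * P + 1 * Q" by simp_all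
  then have P: "P \<in> I" and Q: "Q \<in> I" unfolding I_def by blast+
  obtain D where D: "D \<in> I" "D \<noteq> 0" and min: "\<And>X. X \<in> I \<Longrightarrow> X \<noteq> 0 \<Longrightarrow> degree D \<le> degree X"
    using ex_has_least_nat[of "\<lambda>X. X \<in> I \<and> X \<noteq> 0" P degree] P assms(2) by blast
  have dvd: "primitive_part D dvd X" if X: "X \<in> I" for X
  proof -
    obtain S T where ST: "pseudo_divmod X D = (S, T)" by fastforce
    define c where "c = coeff D (degree D) ^ (Suc (degree X) - degree D)"
    have c: "c \<noteq> 0" using D(2) unfolding c_def by simp
    have eq: "smult c X = D * S + T" unfolding c_def by (rule pseudo_divmod(1)[OF D(2) ST])
    then have "T = smult c X + (- S) * D" by (simp add: algebra_simps)
    then have "T \<in> I" using comb[OF X D(1), of c "- S"] by simp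
    then have "T = 0" using min[of T] pseudo_divmod(2)[OF D(2) ST] by linarith
    then have "primitive_part D dvd primitive_part (smult c X)" using eq by auto
    then have *: "primitive_part D dvd smult (unit_factor c) (primitive_part X)"
      by (simp only: primitive_part_smult)
    obtain v where "1 = unit_factor c * v" using c unit_factor_is_unit by (metis dvdE)
    then have "smult v (smult (unit_factor c) (primitive_part X)) = primitive_part X"
      by (simp add: mult.commute)
    then have "primitive_part D dvd primitive_part X" using dvd_smult[OF *, of v] by simp
    also have "primitive_part X dvd smult (Polynomial.content X) (primitive_part X)"
      by (rule dvd_smult) simp
    also have "\<dots> = X" by (rule content_times_primitive_part)
    finally show ?thesis .
  qed
  have "is_unit (primitive_part D)"
    using assms(1) dvd[OF P] dvd[OF Q] by (rule coprime_common_divisor)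
  then have "degree D = 0" by (metis degree_primitive_part is_unit_poly_iff degree_pCons_0)
  then obtain R where "D = [:R:]" by (metis degree_eq_zeroE)
  with D show ?thesis using that[of R] unfolding I_def by auto
qed

definition slice :: "complex \<Rightarrow> complex poly poly \<Rightarrow> complex poly" where
  "slice w P = map_poly (\<lambda>c. poly c w) P"

lemma poly_slice: "poly (slice w P) z = eval2 P w z"
  by (simp add: slice_def eval2_def)

lemma coeff_slice: "coeff (slice w P) k = poly (coeff P k) w"
  by (simp add: slice_def coeff_map_poly)

lemma degree_slice_le: "degree (slice w P) \<le> degree P"
  unfolding slice_def by (rule map_poly_degree_leq)

text \<open>Bounding $p(rw, \cdot)$ around its value at a point by the doubling estimate and letting
  $r \to 1$ shows that a zero of $p(w, \cdot)$ would force $p(w, \cdot)$ to vanish identically.\<close>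
lemma slice_nonzero_in_disc:
  assumes nz: "\<And>z1 z2. cmod z1 < 1 \<Longrightarrow> cmod z2 < 1 \<Longrightarrow> eval2 P z1 z2 \<noteq> 0"
    and w: "cmod w = 1" and z: "cmod z < 1" and ne: "slice w P \<noteq> 0"
  shows "eval2 P w z \<noteq> 0"
proof
  assume 0: "eval2 P w z = 0"
  \<comment> \<open>For r < 1 all zeros of p(r * w, .) have modulus at least 1, so this radius is
    admissible for every r and does not shrink as r tends to 1.\<close>
  define \<rho> where "\<rho> = 1 - cmod z"
  have rho: "\<rho> > 0" using z unfolding \<rho>_def by simp
  have le: "cmod (eval2 P w x) \<le> 2 ^ degree P * cmod (eval2 P w z)" if x: "cmod (x - z) \<le> \<rho>" for x
  proof (rule tendsto_le)
    have lim: "((\<lambda>r. eval2 P (of_real r * w) y) \<longlongrightarrow> eval2 P w y) (at_left (1::real))" for y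
    proof -
      have "continuous_on UNIV (\<lambda>r::real. eval2 P (of_real r * w) y)"
        by (intro continuous_intros)
      then have "((\<lambda>r. eval2 P (of_real r * w) y) \<longlongrightarrow> eval2 P (of_real 1 * w) y) (at (1::real))"
        unfolding continuous_on_def by (rule bspec) simp
      then show ?thesis by (auto intro: tendsto_mono at_le)
    qed
    show "((\<lambda>r. cmod (eval2 P (of_real r * w) x)) \<longlongrightarrow> cmod (eval2 P w x)) (at_left (1::real))"
      by (intro tendsto_intros lim)
    show "((\<lambda>r. 2 ^ degree P * cmod (eval2 P (of_real r * w) z)) \<longlongrightarrow> 2 ^ degree P * cmod (eval2 P w z)) (at_left (1::real))"
      by (intro tendsto_intros lim)
    have "eventually (\<lambda>r::real. r \<in> {0<..<1}) (at_left 1)"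
      by (rule eventually_at_left_real) simp
    then show "\<forall>\<^sub>F r in at_left (1::real). cmod (eval2 P (of_real r * w) x) \<le> 2 ^ degree P * cmod (eval2 P (of_real r * w) z)"
    proof eventually_elim
      case (elim r)
      let ?S = "slice (of_real r * w) P"
      have rw: "cmod (of_real r * w) < 1" using elim w by (simp add: norm_mult)
      have "\<rho> \<le> cmod (z - a)" if "poly ?S a = 0" for a
      proof -
        have "\<not> cmod a < 1" using that nz[OF rw, of a] by (auto simp: poly_slice)
        then show ?thesis unfolding \<rho>_def
          using norm_triangle_ineq2[of a z] by (simp add: norm_minus_commute)
      qed
      then have "cmod (poly ?S x) \<le> 2 ^ degree ?S * cmod (poly ?S z)"
        using x by (intro poly_doubling[where \<rho> = \<rho>]) auto
      also have "\<dots> \<le> 2 ^ degree P * cmod (poly ?S z)"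
        by (intro mult_right_mono power_increasing degree_slice_le) auto
      finally show ?case by (simp add: poly_slice)
    qed
  qed simp
  have "cball z \<rho> \<subseteq> {x. poly (slice w P) x = 0}"
  proof
    fix x assume "x \<in> cball z \<rho>"
    then have "cmod (x - z) \<le> \<rho>" by (simp add: dist_norm norm_minus_commute)
    then show "x \<in> {x. poly (slice w P) x = 0}" using le[of x] 0 by (simp add: poly_slice)
  qed
  moreover have "infinite (cball z \<rho>)"
    using uncountable_cball[OF rho] countable_finite by blast
  ultimately show False using poly_roots_finite[OF ne] finite_subset by blast
qed

text \<open>At a zero of \<open>P\<close> on the torus \<open>tilde P\<close> vanishes as well,
  which forces \<open>poly R w = 0\<close>. Hence the zeros of \<open>R\<close> contain every w on
  the circle whose slice vanishes somewhere in the closed disc, and they are finitely many.\<close>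

lemma semi_stable_bezout:
  assumes ss: "semi_stable P"
  obtains A B R where "R \<noteq> 0"
    "\<And>w z. eval2 A w z * eval2 P w z + eval2 B w z * eval2 (tilde P) w z = poly R w"
    "\<And>w z. cmod w = 1 \<Longrightarrow> poly R w \<noteq> 0 \<Longrightarrow> cmod z \<le> 1 \<Longrightarrow> eval2 P w z \<noteq> 0"
proof -
  have nz: "eval2 P z1 z2 \<noteq> 0" if "cmod z1 < 1" "cmod z2 < 1" for z1 z2
    using ss that unfolding semi_stable_def by auto
  have "P \<noteq> 0" using nz[of 0 0] by auto
  then obtain A B R where R: "R \<noteq> 0" "A * P + B * tilde P = [:R:]"
    using coprime_imp_bezout_const[of P "tilde P"] ss unfolding semi_stable_def by metis
  have eq: "eval2 A w z * eval2 P w z + eval2 B w z * eval2 (tilde P) w z = poly R w" for w z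
    using arg_cong[OF R(2), of "\<lambda>X. eval2 X w z"] by (simp add: eval2_add eval2_mult)
  have "eval2 P w z \<noteq> 0" if w: "cmod w = 1" "poly R w \<noteq> 0" and z: "cmod z \<le> 1" for w z
  proof -
    have circ: "eval2 P w u \<noteq> 0" if "cmod u = 1" for u
      using eq[of w u] w that by (auto simp: eval2_tilde)
    have "slice w P \<noteq> 0" using circ[of 1] by (auto simp: poly_slice[symmetric])
    then show ?thesis using slice_nonzero_in_disc[OF nz w(1)] circ z by (cases "cmod z = 1") auto
  qed
  with R(1) eq show ?thesis using that by blast
qed

section \<open>Rationality of the slice norms\<close>

text \<open>Requiring equality only off the zeros of \<open>V\<close> encodes rationality up to a
  finite set: further exceptional points, given as zeros of some \<open>W\<close>, are absorbed by
  multiplying both \<open>U\<close> and \<open>V\<close> by \<open>W\<close>.\<close>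

definition rational_on_circle :: "(complex \<Rightarrow> complex) \<Rightarrow> bool" where
  "rational_on_circle \<phi> \<longleftrightarrow>
    (\<exists>U V. V \<noteq> 0 \<and> (\<forall>w. cmod w = 1 \<longrightarrow> poly V w \<noteq> 0 \<longrightarrow> \<phi> w = poly U w / poly V w))"

lemma rational_on_circleI:
  assumes "V \<noteq> 0" "\<And>w. cmod w = 1 \<Longrightarrow> poly V w \<noteq> 0 \<Longrightarrow> \<phi> w = poly U w / poly V w"
  shows "rational_on_circle \<phi>"
  using assms unfolding rational_on_circle_def by blast

lemma rational_on_circle_cong:
  assumes "rational_on_circle \<phi>" "W \<noteq> 0"
    and eq: "\<And>w. cmod w = 1 \<Longrightarrow> poly W w \<noteq> 0 \<Longrightarrow> \<psi> w = \<phi> w"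
  shows "rational_on_circle \<psi>"
proof -
  obtain U V where "V \<noteq> 0" "\<And>w. cmod w = 1 \<Longrightarrow> poly V w \<noteq> 0 \<Longrightarrow> \<phi> w = poly U w / poly V w"
    using assms(1) unfolding rational_on_circle_def by blast
  then show ?thesis using assms(2) eq
    by (intro rational_on_circleI[of "V * W" _ "U * W"]) auto
qed

lemma rational_on_circle_poly: "rational_on_circle (poly P)"
  by (rule rational_on_circleI[of 1 _ P]) auto

lemma rational_on_circle_const: "rational_on_circle (\<lambda>_. c)"
proof -
  have "poly [:c:] = (\<lambda>_. c)" by auto
  then show ?thesis by (metis rational_on_circle_poly)
qed

lemma rational_on_circle_inverse_poly: "P \<noteq> 0 \<Longrightarrow> rational_on_circle (\<lambda>w. inverse (poly P w))"
  by (rule rational_on_circleI[of P _ 1]) (auto simp: field_simps)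

lemma rational_on_circle_add:
  assumes "rational_on_circle \<phi>" "rational_on_circle \<psi>"
  shows "rational_on_circle (\<lambda>w. \<phi> w + \<psi> w)"
proof -
  obtain U V where 1: "V \<noteq> 0" "\<And>w. cmod w = 1 \<Longrightarrow> poly V w \<noteq> 0 \<Longrightarrow> \<phi> w = poly U w / poly V w"
    using assms(1) unfolding rational_on_circle_def by blast
  obtain U' V' where 2: "V' \<noteq> 0" "\<And>w. cmod w = 1 \<Longrightarrow> poly V' w \<noteq> 0 \<Longrightarrow> \<psi> w = poly U' w / poly V' w"
    using assms(2) unfolding rational_on_circle_def by blast
  from 1 2 show ?thesis
    by (intro rational_on_circleI[of "V * V'" _ "U * V' + U' * V"]) (auto simp: field_simps)
qed

lemma rational_on_circle_mult:
  assumes "rational_on_circle \<phi>" "rational_on_circle \<psi>"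
  shows "rational_on_circle (\<lambda>w. \<phi> w * \<psi> w)"
proof -
  obtain U V where 1: "V \<noteq> 0" "\<And>w. cmod w = 1 \<Longrightarrow> poly V w \<noteq> 0 \<Longrightarrow> \<phi> w = poly U w / poly V w"
    using assms(1) unfolding rational_on_circle_def by blast
  obtain U' V' where 2: "V' \<noteq> 0" "\<And>w. cmod w = 1 \<Longrightarrow> poly V' w \<noteq> 0 \<Longrightarrow> \<psi> w = poly U' w / poly V' w"
    using assms(2) unfolding rational_on_circle_def by blast
  from 1 2 show ?thesis
    by (intro rational_on_circleI[of "V * V'" _ "U * U'"]) auto
qed

lemma rational_on_circle_diff:
  assumes "rational_on_circle \<phi>" "rational_on_circle \<psi>"
  shows "rational_on_circle (\<lambda>w. \<phi> w - \<psi> w)"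
  using rational_on_circle_add[OF assms(1) rational_on_circle_mult[OF rational_on_circle_const[of "-1"] assms(2)]]
  by simp

lemma rational_on_circle_sum:
  assumes "\<And>i. i \<in> A \<Longrightarrow> rational_on_circle (\<phi> i)"
  shows "rational_on_circle (\<lambda>w. \<Sum>i\<in>A. \<phi> i w)"
  using assms
  by (induction A rule: infinite_finite_induct)
    (auto intro: rational_on_circle_const rational_on_circle_add)

text \<open>On the circle cnj w = 1/w, so conjugation preserves rationality; the Horner form is
  conjugated one step at a time.\<close>

lemma rational_on_circle_cnj_poly: "rational_on_circle (\<lambda>w. cnj (poly P w))"
proof (induction P)
  case 0
  then show ?case using rational_on_circle_const[of 0] by simp
next
  case (pCons a P)
  have "rational_on_circle (\<lambda>w. cnj a + inverse (poly [:0, 1:] w) * cnj (poly P w))"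
    by (intro rational_on_circle_add rational_on_circle_mult rational_on_circle_const
          rational_on_circle_inverse_poly pCons) auto
  then show ?case
  proof (rule rational_on_circle_cong[where W = 1])
    fix w :: complex assume "cmod w = 1"
    then have "inverse w = cnj w" by (simp add: divide_conv_cnj inverse_eq_divide)
    then show "cnj (poly (pCons a P) w) = cnj a + inverse (poly [:0, 1:] w) * cnj (poly P w)" by simp
  qed simp
qed

lemma rational_on_circle_cnj:
  assumes "rational_on_circle \<phi>"
  shows "rational_on_circle (\<lambda>w. cnj (\<phi> w))"
proof -
  obtain U V where 1: "V \<noteq> 0" "\<And>w. cmod w = 1 \<Longrightarrow> poly V w \<noteq> 0 \<Longrightarrow> \<phi> w = poly U w / poly V w"
    using assms(1) unfolding rational_on_circle_def by blast
  obtain U' V' where 2: "V' \<noteq> 0" "\<And>w. cmod w = 1 \<Longrightarrow> poly V' w \<noteq> 0 \<Longrightarrow> cnj (poly U w) = poly U' w / poly V' w"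
    using rational_on_circle_cnj_poly[of U] unfolding rational_on_circle_def by blast
  obtain U'' V'' where 3: "V'' \<noteq> 0" "\<And>w. cmod w = 1 \<Longrightarrow> poly V'' w \<noteq> 0 \<Longrightarrow> cnj (poly V w) = poly U'' w / poly V'' w"
    using rational_on_circle_cnj_poly[of V] unfolding rational_on_circle_def by blast
  show ?thesis
  proof (cases "U'' = 0")
    \<comment> \<open>Here cnj (V w) = 0 wherever V'' does not vanish, so with denominator V * V''
      there is no point left at which anything has to be checked.\<close>
    case True
    then have "cnj (poly V w) = 0" if "cmod w = 1" "poly V'' w \<noteq> 0" for w
      using 3(2)[OF that] by simp
    then show ?thesis using 1 3(1)
      by (intro rational_on_circleI[of "V * V''" _ 0]) auto
  next
    case False
    show ?thesis
    proof (rule rational_on_circleI[of "V * V' * V'' * U''" _ "U' * V'' * V * V''"])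
      show "V * V' * V'' * U'' \<noteq> 0" using 1 2 3 False by auto
      fix w assume w: "cmod w = 1" "poly (V * V' * V'' * U'') w \<noteq> 0"
      then have "cnj (\<phi> w) = cnj (poly U w) / cnj (poly V w)" using 1(2)[of w] by simp
      also have "\<dots> = (poly U' w / poly V' w) / (poly U'' w / poly V'' w)"
        using w 2(2)[of w] 3(2)[of w] by simp
      also have "\<dots> = poly (U' * V'' * V * V'') w / poly (V * V' * V'' * U'') w"
        using w by (simp add: field_simps)
      finally show "cnj (\<phi> w) = poly (U' * V'' * V * V'') w / poly (V * V' * V'' * U'') w" .
    qed
  qed
qed

section \<open>Fourier moments of the slices\<close>

lemma integral_cis_over_poly_eq_0:
  fixes S :: "complex poly"
  assumes nz: "\<And>z. cmod z \<le> 1 \<Longrightarrow> poly S z \<noteq> 0" and k: "k \<ge> (1::int)"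
  shows "integral {0..2*pi} (\<lambda>t. cis (of_int k * t) / poly S (cis t)) = 0"
proof -
  \<comment> \<open>One power of z is used up by dz = i z dt; the remaining exponent k - 1 is
    nonnegative, so the integrand is holomorphic in the disc and Cauchy's theorem applies.\<close>
  define l where "l = nat (k - 1)"
  let ?f = "\<lambda>z. z ^ l / poly S z"
  have "(?f has_contour_integral 0) (part_circlepath 0 1 0 (2*pi))"
  proof (rule Cauchy_theorem_disc[of "{}" 0 1])
    show "continuous_on (cball 0 1) ?f"
      using nz by (intro continuous_intros) auto
    show "?f field_differentiable at x" if "x \<in> ball 0 1 - {}" for x
      using that nz[of x] by (intro derivative_intros) (auto simp: field_differentiable_def intro!: poly_DERIV)
    show "path_image (part_circlepath 0 1 0 (2*pi)) \<subseteq> cball 0 1"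
      using in_path_image_part_circlepath[of _ 0 1 0 "2*pi"] by auto
  qed (auto simp: exp_eq_1)
  then have "((\<lambda>t. ?f (cis t) * \<i> * cis t) has_integral 0) {0..2*pi}"
    by (simp add: has_contour_integral_part_circlepath_iff)
  then have "((\<lambda>t. - \<i> * (?f (cis t) * \<i> * cis t)) has_integral (- \<i> * 0)) {0..2*pi}"
    by (rule has_integral_mult_right)
  moreover have "- \<i> * (?f (cis t) * \<i> * cis t) = cis (of_int k * t) / poly S (cis t)" for t
  proof -
    have "cis t ^ l * cis t = cis t ^ Suc l" by simp
    also have "\<dots> = cis (of_int k * t)" unfolding Complex.DeMoivre l_def using k by simp
    finally show ?thesis by (simp add: field_simps)
  qed
  ultimately show ?thesis by (simp add: integral_unique)
qed

lemma integral_cis_int: "integral {0..2*pi} (\<lambda>t. cis (of_int k * t)) = (if k = 0 then 2 * of_real pi else 0)"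
proof (cases "k = 0")
  case False
  have "((\<lambda>t. cis (of_int k * t)) has_integral
      (cis (of_int k * (2 * pi)) / (\<i> * of_int k) - cis (of_int k * 0) / (\<i> * of_int k))) {0..2*pi}"
  proof (rule fundamental_theorem_of_calculus)
    fix x :: real
    have "((\<lambda>z. exp (\<i> * (of_int k * z)) / (\<i> * of_int k)) has_field_derivative exp (\<i> * (of_int k * of_real x))) (at (of_real x))"
      using False by (auto intro!: derivative_eq_intros simp: mult.commute[of "exp _" \<i>])
    from has_vector_derivative_real_field[OF this]
    show "((\<lambda>t. cis (of_int k * t) / (\<i> * of_int k)) has_vector_derivative cis (of_int k * x)) (at x within {0..2*pi})"
      by (simp add: cis_conv_exp o_def has_vector_derivative_at_within)
  qed simp
  moreover have "cis (of_int k * (2 * pi)) = 1"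
    using cis_multiple_2pi[of "of_int k"] by (simp add: mult.commute)
  ultimately show ?thesis using False by (simp add: integral_unique)
qed (simp add: scaleR_conv_of_real)

lemma
  fixes f :: "'i \<Rightarrow> real \<Rightarrow> complex"
  assumes "finite A" "\<And>j. j \<in> A \<Longrightarrow> f j integrable_on S"
  shows integrable_linear_combination: "(\<lambda>t. \<Sum>j\<in>A. c j * f j t) integrable_on S"
    and integral_linear_combination:
      "integral S (\<lambda>t. \<Sum>j\<in>A. c j * f j t) = (\<Sum>j\<in>A. c j * integral S (f j))"
proof -
  have "((\<lambda>t. \<Sum>j\<in>A. c j * f j t) has_integral (\<Sum>j\<in>A. c j * integral S (f j))) S"
    using assms by (intro has_integral_sum has_integral_mult_right integrable_integral)
  then show "(\<lambda>t. \<Sum>j\<in>A. c j * f j t) integrable_on S"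
    "integral S (\<lambda>t. \<Sum>j\<in>A. c j * f j t) = (\<Sum>j\<in>A. c j * integral S (f j))"
    by (auto simp: integral_unique integrable_on_def)
qed

text \<open>The Fourier coefficient of 1/p(w, .) at index -k, without the factor 1/(2 pi).\<close>

definition moment :: "complex poly poly \<Rightarrow> int \<Rightarrow> complex \<Rightarrow> complex" where
  "moment P k w = integral {0..2*pi} (\<lambda>t. cis (of_int k * t) / eval2 P w (cis t))"

context
  fixes P :: "complex poly poly" and R :: "complex poly"
  assumes R: "R \<noteq> 0" and nz: "\<And>w z. cmod w = 1 \<Longrightarrow> poly R w \<noteq> 0 \<Longrightarrow> cmod z \<le> 1 \<Longrightarrow> eval2 P w z \<noteq> 0"
begin

lemma moment_pos:
  assumes "cmod w = 1" "poly R w \<noteq> 0" "k \<ge> 1"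
  shows "moment P k w = 0"
  unfolding moment_def using integral_cis_over_poly_eq_0[of "slice w P" k] nz[OF assms(1,2)] assms(3)
  by (simp add: poly_slice)

text \<open>The sum reassembles p(w, z) under the integral and cancels the denominator, leaving the
  integral of a pure power of z.\<close>

lemma moment_rec:
  assumes w: "cmod w = 1" "poly R w \<noteq> 0"
  shows "(\<Sum>j\<le>degree P. poly (coeff P j) w * moment P (int j + k) w) = (if k = 0 then 2 * of_real pi else 0)"
proof -
  have nz': "eval2 P w (cis t) \<noteq> 0" for t using nz[OF w] by simp
  have int: "(\<lambda>t. cis (of_int k * t) / eval2 P w (cis t)) integrable_on {0..2*pi}" for k
    using nz' by (intro integrable_continuous_interval continuous_intros) auto
  have "(\<Sum>j\<le>degree P. poly (coeff P j) w * moment P (int j + k) w)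
      = integral {0..2*pi} (\<lambda>t. \<Sum>j\<le>degree P. poly (coeff P j) w * (cis (of_int (int j + k) * t) / eval2 P w (cis t)))"
    unfolding moment_def by (rule integral_linear_combination[symmetric]) (intro finite_atMost int)+
  also have "\<dots> = integral {0..2*pi} (\<lambda>t. cis (of_int k * t))"
  proof (rule integral_cong)
    fix t
    have "(\<Sum>j\<le>degree P. poly (coeff P j) w * (cis (of_int (int j + k) * t) / eval2 P w (cis t)))
        = (\<Sum>j\<le>degree P. poly (coeff P j) w * cis t ^ j) * cis (of_int k * t) / eval2 P w (cis t)"
      unfolding Complex.DeMoivre sum_distrib_right sum_divide_distrib
      by (intro sum.cong) (simp_all add: distrib_right flip: cis_mult)
    also have "\<dots> = cis (of_int k * t)" using nz' by (simp flip: eval2_altdef)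
    finally show "(\<Sum>j\<le>degree P. poly (coeff P j) w * (cis (of_int (int j + k) * t) / eval2 P w (cis t))) = cis (of_int k * t)" .
  qed
  finally show ?thesis by (simp add: integral_cis_int)
qed

lemma rational_moment:
  assumes c0: "coeff P 0 \<noteq> 0"
  shows "rational_on_circle (moment P k)"
\<comment> \<open>The measure is 0 exactly for k \<ge> 1, where the moments vanish. For k \<le> 0
  the recursion is solved for its lowest moment, dividing by the z2-constant coefficient of
  \<open>P\<close>.\<close>
proof (induction "nat (1 - k)" arbitrary: k rule: less_induct)
  case less
  show ?case
  proof (cases "k \<ge> 1")
    case True
    show ?thesis
      by (rule rational_on_circle_cong[OF rational_on_circle_const[of 0] R]) (use True moment_pos in auto)
  next
    case False
    have "rational_on_circle (\<lambda>w. inverse (poly (coeff P 0) w) * ((if k = 0 then 2 * of_real pi else 0) -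
        (\<Sum>j=1..degree P. poly (coeff P j) w * moment P (int j + k) w)))"
      by (intro rational_on_circle_mult rational_on_circle_diff rational_on_circle_sum
          rational_on_circle_const rational_on_circle_poly rational_on_circle_inverse_poly c0 less)
        (use False in auto)
    then show ?thesis
    proof (rule rational_on_circle_cong[where W = "R * coeff P 0"])
      show "R * coeff P 0 \<noteq> 0" using R c0 by simp
      fix w assume w: "cmod w = 1" "poly (R * coeff P 0) w \<noteq> 0"
      then have "(\<Sum>j\<le>degree P. poly (coeff P j) w * moment P (int j + k) w) = (if k = 0 then 2 * of_real pi else 0)"
        by (intro moment_rec) auto
      then have "poly (coeff P 0) w * moment P k w + (\<Sum>j=1..degree P. poly (coeff P j) w * moment P (int j + k) w) = (if k = 0 then 2 * of_real pi else 0)"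
        by (simp add: atMost_atLeast0 sum.atLeast_Suc_atMost)
      then have "poly (coeff P 0) w * moment P k w = (if k = 0 then 2 * of_real pi else 0) -
        (\<Sum>j=1..degree P. poly (coeff P j) w * moment P (int j + k) w)"
        by (simp add: eq_diff_eq)
      then show "moment P k w = inverse (poly (coeff P 0) w) * ((if k = 0 then 2 * of_real pi else 0) -
        (\<Sum>j=1..degree P. poly (coeff P j) w * moment P (int j + k) w))"
        using w by (simp add: field_simps)
    qed
  qed
qed

end


definition moment2 :: "complex poly poly \<Rightarrow> int \<Rightarrow> complex \<Rightarrow> complex" where
  "moment2 P k w = integral {0..2*pi} (\<lambda>t. cis (of_int k * t) / of_real ((cmod (eval2 P w (cis t)))\<^sup>2))"

text \<open>The Bezout relation $A p + B \tilde p = R$ splits $R / |p|^2$ into $A / \bar p + z_1^n z_2^m B / p$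
  on the torus.\<close>
lemma rational_moment2:
  assumes ss: "semi_stable P"
  shows "rational_on_circle (moment2 P k)"
proof -
  obtain A B R where R: "R \<noteq> 0"
    and bez: "\<And>w z. eval2 A w z * eval2 P w z + eval2 B w z * eval2 (tilde P) w z = poly R w"
    and nz: "\<And>w z. cmod w = 1 \<Longrightarrow> poly R w \<noteq> 0 \<Longrightarrow> cmod z \<le> 1 \<Longrightarrow> eval2 P w z \<noteq> 0"
    by (rule semi_stable_bezout[OF ss]) blast
  \<comment> \<open>Nonvanishing at the origin makes the z2-constant coefficient a nonzero
    polynomial in z1, as the recursion for the moments demands.\<close>
  have "eval2 P 0 0 \<noteq> 0" using ss unfolding semi_stable_def by auto
  then have c0: "coeff P 0 \<noteq> 0" by (auto simp: eval2_conv_poly_poly poly_0_coeff_0)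
  let ?n = "deg1 P" and ?m = "degree P"
  have eq: "moment2 P k w = inverse (poly R w) *
      ((\<Sum>j\<le>degree A. poly (coeff A j) w * cnj (moment P (- (int j + k)) w)) +
       poly (monom 1 ?n) w * (\<Sum>j\<le>degree B. poly (coeff B j) w * moment P (int j + (int ?m + k)) w))"
    if w: "cmod w = 1" "poly R w \<noteq> 0" for w
  proof -
    have nz': "eval2 P w (cis t) \<noteq> 0" for t using nz[OF w] by simp
    have int: "(\<lambda>t. cis (of_int k * t) / eval2 P w (cis t)) integrable_on {0..2*pi}"
      "(\<lambda>t. cis (of_int k * t) / cnj (eval2 P w (cis t))) integrable_on {0..2*pi}" for k
      using nz' by (auto intro!: integrable_continuous_interval continuous_intros)
    have cnj_moment: "cnj (moment P (- l) w) = integral {0..2*pi} (\<lambda>t. cis (of_int l * t) / cnj (eval2 P w (cis t)))" for l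
      unfolding moment_def by (subst integral_cnj) (simp add: cis_cnj)
    have pt: "poly R w * (cis (of_int k * t) / of_real ((cmod (eval2 P w (cis t)))\<^sup>2))
       = (\<Sum>j\<le>degree A. poly (coeff A j) w * (cis (of_int (int j + k) * t) / cnj (eval2 P w (cis t)))) +
         w ^ ?n * (\<Sum>j\<le>degree B. poly (coeff B j) w * (cis (of_int (int j + (int ?m + k)) * t) / eval2 P w (cis t)))"
      (is "?l = ?r") for t
    proof -
      let ?z = "cis t" and ?p = "eval2 P w (cis t)"
      have "?l = (eval2 A w ?z * ?p + eval2 B w ?z * (w ^ ?n * ?z ^ ?m * cnj ?p)) * (cis (of_int k * t) / (?p * cnj ?p))"
        unfolding complex_norm_square bez[of w ?z, symmetric] eval2_tilde[OF w(1) norm_cis] ..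
      also have "\<dots> = eval2 A w ?z * cis (of_int k * t) / cnj ?p
          + w ^ ?n * (eval2 B w ?z * (?z ^ ?m * cis (of_int k * t)) / ?p)"
        using nz'[of t] by (simp add: field_simps)
      also have "eval2 A w ?z * cis (of_int k * t) / cnj ?p = (\<Sum>j\<le>degree A. poly (coeff A j) w * (cis (of_int (int j + k) * t) / cnj ?p))"
        unfolding eval2_altdef[OF order_refl, of A] Complex.DeMoivre sum_distrib_right sum_divide_distrib
        by (intro sum.cong) (simp_all add: distrib_right flip: cis_mult)
      also have "eval2 B w ?z * (?z ^ ?m * cis (of_int k * t)) / ?p = (\<Sum>j\<le>degree B. poly (coeff B j) w * (cis (of_int (int j + (int ?m + k)) * t) / ?p))"
        unfolding eval2_altdef[OF order_refl, of B] Complex.DeMoivre sum_distrib_right sum_divide_distrib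
        by (intro sum.cong) (simp_all add: distrib_right flip: cis_mult)
      finally show ?thesis .
    qed
    have "poly R w * moment2 P k w = integral {0..2*pi} (\<lambda>t.
         (\<Sum>j\<le>degree A. poly (coeff A j) w * (cis (of_int (int j + k) * t) / cnj (eval2 P w (cis t)))) +
         w ^ ?n * (\<Sum>j\<le>degree B. poly (coeff B j) w * (cis (of_int (int j + (int ?m + k)) * t) / eval2 P w (cis t))))"
      unfolding moment2_def integral_mult_right[symmetric] pt ..
    also have "\<dots> = (\<Sum>j\<le>degree A. poly (coeff A j) w * cnj (moment P (- (int j + k)) w)) +
       w ^ ?n * (\<Sum>j\<le>degree B. poly (coeff B j) w * moment P (int j + (int ?m + k)) w)"
      unfolding cnj_moment unfolding moment_def
      by (simp only: Henstock_Kurzweil_Integration.integral_add integral_mult_right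
          integral_linear_combination integrable_linear_combination integrable_on_mult_right int finite_atMost)
    finally show ?thesis using w by (simp add: poly_monom field_simps)
  qed
  have "rational_on_circle (\<lambda>w. inverse (poly R w) *
      ((\<Sum>j\<le>degree A. poly (coeff A j) w * cnj (moment P (- (int j + k)) w)) +
       poly (monom 1 ?n) w * (\<Sum>j\<le>degree B. poly (coeff B j) w * moment P (int j + (int ?m + k)) w)))"
    by (intro rational_on_circle_mult rational_on_circle_add rational_on_circle_sum rational_on_circle_cnj
       rational_on_circle_poly rational_on_circle_inverse_poly rational_moment[OF R nz] c0 R) auto
  then show ?thesis using R eq by (rule rational_on_circle_cong)
qed

text \<open>On the circle |q(w, z)|^2 is a Laurent polynomial in z, so the norm is a finite
  combination of moments of 1/|p|^2 whose coefficients are rational in w.\<close>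

lemma rational_circ_norm:
  assumes ss: "semi_stable P"
  shows "rational_on_circle (\<lambda>w. of_real (circ_norm (slice w Q) (slice w P)))"
proof -
  obtain R where R: "R \<noteq> 0"
    and nz: "\<And>w z. cmod w = 1 \<Longrightarrow> poly R w \<noteq> 0 \<Longrightarrow> cmod z \<le> 1 \<Longrightarrow> eval2 P w z \<noteq> 0"
    by (rule semi_stable_bezout[OF ss]) blast
  let ?N = "degree Q"
  have eq: "of_real (circ_norm (slice w Q) (slice w P)) =
     (\<Sum>i\<le>?N. \<Sum>j\<le>?N. poly (coeff Q i) w * cnj (poly (coeff Q j) w) * moment2 P (int i - int j) w)"
    if w: "cmod w = 1" "poly R w \<noteq> 0" for w
  proof -
    have nz': "eval2 P w (cis t) \<noteq> 0" for t using nz[OF w] by simp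
    have int: "(\<lambda>t. cis (of_int k * t) / of_real ((cmod (eval2 P w (cis t)))\<^sup>2)) integrable_on {0..2*pi}" for k
      using nz' by (auto intro!: integrable_continuous_interval continuous_intros)
    have pt: "of_real ((cmod (eval2 Q w (cis t)))\<^sup>2 / (cmod (eval2 P w (cis t)))\<^sup>2) =
      (\<Sum>i\<le>?N. \<Sum>j\<le>?N. poly (coeff Q i) w * cnj (poly (coeff Q j) w) * (cis (of_int (int i - int j) * t) / of_real ((cmod (eval2 P w (cis t)))\<^sup>2)))" for t
    proof -
      have "complex_of_real ((cmod (eval2 Q w (cis t)))\<^sup>2) = (\<Sum>i\<le>?N. \<Sum>j\<le>?N. (poly (coeff Q i) w * cis t ^ i) * cnj (poly (coeff Q j) w * cis t ^ j))"
        unfolding complex_norm_square eval2_altdef[OF order_refl, of Q] by (simp add: sum_product)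
      also have "\<dots> = (\<Sum>i\<le>?N. \<Sum>j\<le>?N. poly (coeff Q i) w * cnj (poly (coeff Q j) w) * cis (of_int (int i - int j) * t))"
        unfolding Complex.DeMoivre
        by (intro sum.cong refl) (simp add: cis_cnj cis_mult left_diff_distrib)
      finally show ?thesis by (simp add: sum_divide_distrib)
    qed
    have "of_real (circ_norm (slice w Q) (slice w P)) =
      integral {0..2*pi} (\<lambda>t. complex_of_real ((cmod (eval2 Q w (cis t)))\<^sup>2 / (cmod (eval2 P w (cis t)))\<^sup>2))"
      unfolding circ_norm_def poly_slice using nz'
      by (intro integral_unique[symmetric] has_integral_of_real integrable_integral
          integrable_continuous_interval continuous_intros) auto
    also have "\<dots> = (\<Sum>i\<le>?N. \<Sum>j\<le>?N. poly (coeff Q i) w * cnj (poly (coeff Q j) w) * moment2 P (int i - int j) w)"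
      unfolding pt moment2_def sum.cartesian_product case_prod_unfold
      by (rule integral_linear_combination) (intro finite_cartesian_product finite_atMost int)+
    finally show ?thesis .
  qed
  have "rational_on_circle (\<lambda>w. \<Sum>i\<le>?N. \<Sum>j\<le>?N. poly (coeff Q i) w * cnj (poly (coeff Q j) w) * moment2 P (int i - int j) w)"
    by (intro rational_on_circle_mult rational_on_circle_sum rational_on_circle_cnj
       rational_on_circle_poly rational_moment2 ss)
  then show ?thesis using R eq by (rule rational_on_circle_cong)
qed

section \<open>Boundedness of the slice norms\<close>

lemma eventually_at_right_poly_cis_nonzero:
  assumes "V \<noteq> (0::complex poly)"
  shows "eventually (\<lambda>s. poly V (cis s) \<noteq> 0) (at_right s0)"
proof -
  have "finite {z. poly V z = 0}" using assms by (rule poly_roots_finite)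
  then have "eventually (\<lambda>z. z \<notin> {z. poly V z = 0}) (at (cis s0))"
    using islimpt_finite islimpt_iff_eventually by blast
  moreover have "filterlim cis (at (cis s0)) (at_right s0)"
  proof (subst filterlim_at, intro conjI)
    show "(cis \<longlongrightarrow> cis s0) (at_right s0)" by (intro tendsto_intros)
    have "eventually (\<lambda>s. s \<in> {s0<..<s0 + 2*pi}) (at_right s0)"
      by (rule eventually_at_right_real) simp
    then show "\<forall>\<^sub>F s in at_right s0. cis s \<in> UNIV \<and> cis s \<noteq> cis s0"
    proof eventually_elim
      case (elim s)
      have "cis s \<noteq> cis s0"
      proof
        assume "cis s = cis s0"
        then have "cis (s - s0) = 1" by (simp flip: cis_divide)
        then have "cos (s - s0) = 1" by (metis Re_complex_of_real cis.simps(1) of_real_1)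
        then obtain n :: int where "s - s0 = of_int n * 2 * pi" using cos_one_2pi_int by blast
        then have n: "s - s0 = of_int n * (2 * pi)" by (simp only: mult.assoc)
        have "of_int n > (0::real)" using n elim by (smt (verit) greaterThanLessThan_iff mult_nonpos_nonneg pi_gt_zero)
        then have "of_int n * (2 * pi) \<ge> 1 * (2 * pi)" by (intro mult_right_mono) auto
        then show False using n elim unfolding greaterThanLessThan_iff by linarith
      qed
      then show ?case by simp
    qed
  qed
  ultimately show ?thesis unfolding filterlim_iff by (auto elim: eventually_mono)
qed

text \<open>The logarithmic divergence of the integral of c / (s - a).\<close>

lemma not_integrable_near_pole:
  fixes f :: "real \<Rightarrow> real"
  assumes int: "f integrable_on {A..B}" and nonneg: "\<And>s. 0 \<le> f s"
    and ab: "A \<le> a" "a < b" "b \<le> B" and c: "c > 0"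
    and le: "\<And>s. s \<in> {a<..b} \<Longrightarrow> c / (s - a) \<le> f s"
  shows False
proof -
  define M where "M = integral {A..B} f"
  have M: "M \<ge> 0" unfolding M_def by (rule integral_nonneg[OF int]) (use nonneg in auto)
  \<comment> \<open>Chosen so that c * ln ((b - a) / \<eta>) = M + 1, which exceeds the total
    integral M.\<close>
  define \<eta> where "\<eta> = (b - a) * exp (- ((M + 1) / c))"
  have eta: "\<eta> > 0" "\<eta> \<le> b - a" using ab M c unfolding \<eta>_def by (auto intro!: mult_left_le divide_nonneg_pos)
  have "((\<lambda>s. c / (s - a)) has_integral (c * ln (b - a) - c * ln (a + \<eta> - a))) {a + \<eta>..b}"
  proof (rule fundamental_theorem_of_calculus)
    fix s assume "s \<in> {a + \<eta>..b}"
    then show "((\<lambda>s. c * ln (s - a)) has_vector_derivative c / (s - a)) (at s within {a + \<eta>..b})"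
      using eta by (auto intro!: derivative_eq_intros simp flip: has_real_derivative_iff_has_vector_derivative)
  qed (use eta in auto)
  then have I: "((\<lambda>s. c / (s - a)) has_integral (c * (ln (b - a) - ln \<eta>))) {a + \<eta>..b}"
    by (simp add: right_diff_distrib)
  have sub: "{a + \<eta>..b} \<subseteq> {A..B}" using ab eta by auto
  have int': "f integrable_on {a + \<eta>..b}" by (rule integrable_on_subinterval[OF int sub])
  have "c * (ln (b - a) - ln \<eta>) \<le> integral {a + \<eta>..b} f"
    using has_integral_le[OF I integrable_integral[OF int']] le eta by auto
  also have "\<dots> \<le> M" unfolding M_def
    by (rule integral_subset_le[OF sub int' int]) (use nonneg in auto)
  also have "ln \<eta> = ln (b - a) - (M + 1) / c" unfolding \<eta>_def using ab by (simp add: ln_mult)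
  finally show False using c by simp
qed

lemma bounded_on_circle:
  fixes f :: "complex \<Rightarrow> real"
  assumes "continuous_on (sphere 0 1) f"
  obtains K where "K > 0" "\<And>w. cmod w = 1 \<Longrightarrow> f w \<le> K"
proof -
  have "bounded (f ` sphere 0 1)"
    by (intro compact_imp_bounded compact_continuous_image assms) auto
  then obtain K where "K > 0" "\<forall>x\<in>f ` sphere 0 1. norm x \<le> K" by (metis bounded_pos)
  then show ?thesis using that[of K] by force
qed

text \<open>In lowest terms, an integrable $U/V$ cannot have a zero of $V$ on the circle.\<close>
lemma rational_integrable_imp_bounded:
  assumes rat: "rational_on_circle \<phi>" and int: "(\<lambda>s. cmod (\<phi> (cis s))) integrable_on {0..2*pi}"
  obtains C W where "W \<noteq> 0" "\<And>w. cmod w = 1 \<Longrightarrow> poly W w \<noteq> 0 \<Longrightarrow> cmod (\<phi> w) \<le> C"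
proof -
  obtain U V where V: "V \<noteq> 0" and UV: "\<And>w. cmod w = 1 \<Longrightarrow> poly V w \<noteq> 0 \<Longrightarrow> \<phi> w = poly U w / poly V w"
    using rat unfolding rational_on_circle_def by blast
  have "gcd U V \<noteq> 0" using V by simp
  then obtain U' V' where U': "U = U' * gcd U V" "V = V' * gcd U V" "coprime U' V'"
    using gcd_coprime_exists by blast
  have V'0: "V' \<noteq> 0" using V U'(2) by auto
  have eq: "\<phi> w = poly U' w / poly V' w" if "cmod w = 1" "poly V w \<noteq> 0" for w
  proof -
    have "poly U w = poly U' w * poly (gcd U V) w" "poly V w = poly V' w * poly (gcd U V) w"
      by (metis U'(1) poly_mult, metis U'(2) poly_mult)
    then show ?thesis using UV[OF that] that by auto
  qed
  have nz: "poly V' w0 \<noteq> 0" if w0: "cmod w0 = 1" for w0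
  proof
    assume 0: "poly V' w0 = 0"
    \<comment> \<open>The half-open range leaves room to the right of \<open>s0\<close> inside
      \<open>{0..2*pi}\<close>, so one-sided limits cover every point of the circle.\<close>
    obtain s0 where s0: "0 \<le> s0" "s0 < 2*pi" "w0 = cis s0"
      using w0 by (metis Arg2pi_ge_0 Arg2pi_lt_2pi Arg2pi_eq cis_conv_exp mult_1 of_real_1 complex_norm_eq_1_exp_eq)
    have U0: "poly U' w0 \<noteq> 0" using U'(3) 0 coprime_poly_0 by blast
    define a where "a = cmod (poly U' w0) / 2"
    have a: "a > 0" using U0 unfolding a_def by simp
    have "((\<lambda>s. cmod (poly U' (cis s))) \<longlongrightarrow> cmod (poly U' (cis s0))) (at_right s0)"
      by (intro tendsto_intros)
    then have evU: "eventually (\<lambda>s. a < cmod (poly U' (cis s))) (at_right s0)"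
      by (rule order_tendstoD(1)) (use a s0(3) in \<open>simp add: a_def\<close>)
    have "eventually (\<lambda>s. s \<in> {s0<..<2*pi}) (at_right s0)"
      using s0 by (intro eventually_at_right_real)
    then have "eventually (\<lambda>s. a < cmod (poly U' (cis s)) \<and> poly V (cis s) \<noteq> 0 \<and> s < 2 * pi) (at_right s0)"
      using evU eventually_at_right_poly_cis_nonzero[OF V, of s0] by eventually_elim auto
    then obtain b where b: "b > s0" and bP: "\<And>s. s0 < s \<Longrightarrow> s < b \<Longrightarrow> a < cmod (poly U' (cis s)) \<and> poly V (cis s) \<noteq> 0 \<and> s < 2 * pi"
      unfolding eventually_at_right_field by blast
    define b' where "b' = (s0 + b) / 2"
    have b': "s0 < b'" "b' < b" using b unfolding b'_def by auto
    \<comment> \<open>By the Lipschitz bound V' is at most L * (s - s0) near its zero while U' stays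
      above \<open>a\<close>; a pole of any order thus dominates a simple one. Adding 1 only ensures
      L > 0.\<close>
    define L where "L = lip_bound (degree V') V' + 1"
    have L: "L > 0" unfolding L_def lip_bound_def by (intro add_nonneg_pos sum_nonneg) auto
    have "a / L / (s - s0) \<le> cmod (\<phi> (cis s))" if s: "s \<in> {s0<..b'}" for s
    proof -
      have P: "a < cmod (poly U' (cis s))" "poly V (cis s) \<noteq> 0" using bP[of s] s b' by auto
      then have V's: "poly V' (cis s) \<noteq> 0" by (metis U'(2) mult_eq_0_iff poly_mult)
      have "cmod (poly V' (cis s)) = cmod (poly V' (cis s) - poly V' (cis s0))" using 0 s0 by simp
      also have "\<dots> \<le> lip_bound (degree V') V' * cmod (cis s - cis s0)"
        by (intro cmod_poly_diff_le_lip_bound) auto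
      also have "\<dots> \<le> L * (s - s0)"
        using cmod_cis_diff_le[of s s0] s L unfolding L_def by (intro mult_mono) auto
      finally have "a / (L * (s - s0)) \<le> cmod (poly U' (cis s)) / cmod (poly V' (cis s))"
        using P a V's by (intro frac_le) auto
      then show ?thesis using eq[of "cis s"] P(2) by (simp add: norm_divide)
    qed
    moreover have "b' \<le> 2 * pi" using bP[of b'] b' by auto
    ultimately show False
      using not_integrable_near_pole[OF int, of s0 b' "a / L"] s0 b' a L by auto
  qed
  have "continuous_on (sphere 0 1) (\<lambda>w. cmod (poly U' w / poly V' w))"
    using nz by (intro continuous_intros) auto
  then obtain K where "\<And>w. cmod w = 1 \<Longrightarrow> cmod (poly U' w / poly V' w) \<le> K"
    using bounded_on_circle by blast
  then show ?thesis using that[of V K] V eq by metis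
qed

section \<open>From square integrability on the torus to the slices\<close>

lemma continuous_on_eval2_cis: "continuous_on S (\<lambda>x. eval2 P (cis (fst x)) (cis (snd x)))"
  by (intro continuous_intros)

lemma borel_measurable_quot_torus: "quot_torus Q P \<in> borel_measurable borel"
proof -
  have m: "(\<lambda>x. eval2 Q (cis (fst x)) (cis (snd x))) \<in> borel_measurable borel" for Q
    by (rule borel_measurable_continuous_onI[OF continuous_on_eval2_cis])
  show ?thesis unfolding quot_torus_def case_prod_unfold
    using m[of Q] m[of P] by (rule borel_measurable_divide)
qed

text \<open>For nonnegative Borel functions gauge and Lebesgue integrability coincide, and both
  integrals are 0 by convention when it fails. The equality thus holds for every slice, including
  those where the integral diverges.\<close>

lemma integral_eq_LBINT_nonneg:
  fixes g :: "real \<Rightarrow> real"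
  assumes "g \<in> borel_measurable borel" "\<And>x. 0 \<le> g x"
  shows "integral {a..b} g = (LBINT x:{a..b}. g x)"
proof (cases "set_integrable lborel {a..b} g")
  case True
  then show ?thesis by (rule set_borel_integral_eq_integral(2)[symmetric])
next
  case False
  have "\<not> g integrable_on {a..b}"
  proof
    assume "g integrable_on {a..b}"
    then have "g absolutely_integrable_on {a..b}"
      using assms by (intro nonnegative_absolutely_integrable_1) auto
    then have "set_integrable lborel {a..b} g"
      unfolding set_integrable_def using assms(1) by (subst (asm) integrable_completion) auto
    with False show False ..
  qed
  then show ?thesis using False
    by (simp add: not_integrable_integral set_lebesgue_integral_def set_integrable_def not_integrable_integral_eq)
qed

text \<open>Fubini's theorem, after passing from completed Lebesgue measure to the Borel product
  measure; this is possible because the integrand is Borel.\<close>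

lemma Ip_imp_circ_norm_integrable:
  assumes "Q \<in> Ip P"
  shows "(\<lambda>s. circ_norm (slice (cis s) Q) (slice (cis s) P)) integrable_on {0..2*pi}"
proof -
  let ?I = "{0..2*pi}"
  let ?F = "\<lambda>x. (cmod (quot_torus Q P x))\<^sup>2"
  let ?f = "\<lambda>x. indicator (?I \<times> ?I) x *\<^sub>R ?F x"
  have mF: "?F \<in> borel_measurable borel"
    using borel_measurable_quot_torus by measurable
  have sets: "?I \<times> ?I \<in> sets (borel :: (real \<times> real) measure)"
    by (intro borel_closed closed_Times) auto
  have mf: "?f \<in> borel_measurable lborel"
    using mF sets by measurable
  have "integrable torus ?F" using assms unfolding Ip_def L2_torus_def by auto
  then have "integrable lebesgue ?f"
    unfolding torus_def using sets by (subst (asm) integrable_restrict_space) auto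
  then have "integrable lborel ?f" using mf by (simp add: integrable_completion)
  then have "integrable (lborel \<Otimes>\<^sub>M lborel) ?f" by (simp add: lborel_prod)
  then have "integrable lborel (\<lambda>s. LBINT t. ?f (s, t))" by (rule lborel_pair.integrable_fst')
  moreover have "(LBINT t. ?f (s, t)) = indicator ?I s *\<^sub>R circ_norm (slice (cis s) Q) (slice (cis s) P)" for s
  proof -
    have "(\<lambda>t. ?F (s, t)) \<in> borel_measurable borel"
      using mF by (rule measurable_compose[rotated]) simp
    then have "integral ?I (\<lambda>t. ?F (s, t)) = (LBINT t:?I. ?F (s, t))"
      by (rule integral_eq_LBINT_nonneg) simp
    also have "integral ?I (\<lambda>t. ?F (s, t)) = circ_norm (slice (cis s) Q) (slice (cis s) P)"
      unfolding circ_norm_def by (simp add: quot_torus_def poly_slice norm_divide power_divide)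
    finally show ?thesis unfolding set_lebesgue_integral_def
      by (cases "s \<in> ?I") (simp_all add: indicator_times)
  qed
  ultimately have "set_integrable lborel ?I (\<lambda>s. circ_norm (slice (cis s) Q) (slice (cis s) P))"
    unfolding set_integrable_def by simp
  then show ?thesis by (rule set_borel_integral_eq_integral(1))
qed

lemma Ip_imp_circ_norm_bounded:
  assumes "semi_stable P" "Q \<in> Ip P"
  obtains C W where "W \<noteq> 0" "\<And>w. cmod w = 1 \<Longrightarrow> poly W w \<noteq> 0 \<Longrightarrow> circ_norm (slice w Q) (slice w P) \<le> C"
proof -
  have "(\<lambda>s. cmod (complex_of_real (circ_norm (slice (cis s) Q) (slice (cis s) P)))) integrable_on {0..2*pi}"
    using Ip_imp_circ_norm_integrable[OF assms(2)] by (simp add: circ_norm_nonneg)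
  then show ?thesis
    using rational_integrable_imp_bounded[OF rational_circ_norm[OF assms(1), of Q]] that
    by (smt (verit) norm_of_real)
qed


lemma detN_row_combination:
  fixes M :: "nat \<Rightarrow> nat \<Rightarrow> 'a::comm_ring_1"
  assumes "k < n"
  obtains C where "\<And>j. j < n \<Longrightarrow> (\<Sum>i<n. C i * M i j) = (if j = k then detN n M else 0)"
proof -
  let ?A = "Matrix.mat n n (\<lambda>(i, j). M i j)"
  have A: "?A \<in> carrier_mat n n" by simp
  have less: "\<sigma> i < n" if "\<sigma> permutes {..<n}" "i < n" for \<sigma> i
    using permutes_in_image[OF that(1), of i] that(2) by simp
  have det: "Determinant.det ?A = detN n M"
    unfolding det_def'[OF A] detN_def atLeast0LessThan
    by (intro sum.cong refl arg_cong2[where f = "(*)"] prod.cong)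
      (auto simp: less)
  \<comment> \<open>The multipliers are row k of the adjugate, that is, the cofactors of column k of
    \<open>M\<close>.\<close>
  have "(\<Sum>i<n. (adj_mat ?A $$ (k, i)) * M i j) = (if j = k then detN n M else 0)" if j: "j < n" for j
  proof -
    have "(\<Sum>i<n. (adj_mat ?A $$ (k, i)) * M i j) = (adj_mat ?A * ?A) $$ (k, j)"
      using assms j adj_mat(1)[OF A] by (simp add: scalar_prod_def atLeast0LessThan)
    also have "\<dots> = (if j = k then detN n M else 0)"
      unfolding adj_mat(3)[OF A] det using assms j by simp
    finally show ?thesis .
  qed
  then show ?thesis by (rule that)
qed

lemma circ_norm_sum_le:
  fixes F :: "nat \<Rightarrow> complex poly"
  assumes nz: "\<And>t. poly P (cis t) \<noteq> 0"
  shows "circ_norm (\<Sum>i<m. smult (c i) (F i)) P \<le> real m * (\<Sum>i<m. (cmod (c i))\<^sup>2 * circ_norm (F i) P)"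
proof -
  let ?p = "\<lambda>t. (cmod (poly P (cis t)))\<^sup>2"
  have int: "(\<lambda>t. (cmod (poly Q (cis t)))\<^sup>2 / ?p t) integrable_on {0..2*pi}" for Q
    by (intro integrable_continuous_interval continuous_on_circ_norm_integrand nz)
  have has: "((\<lambda>t. real m * (\<Sum>i<m. (cmod (c i))\<^sup>2 * ((cmod (poly (F i) (cis t)))\<^sup>2 / ?p t)))
     has_integral real m * (\<Sum>i<m. (cmod (c i))\<^sup>2 * circ_norm (F i) P)) {0..2*pi}"
    unfolding circ_norm_def
    by (intro has_integral_mult_right has_integral_sum integrable_integral int finite_lessThan)
  have "circ_norm (\<Sum>i<m. smult (c i) (F i)) P
      \<le> integral {0..2*pi} (\<lambda>t. real m * (\<Sum>i<m. (cmod (c i))\<^sup>2 * ((cmod (poly (F i) (cis t)))\<^sup>2 / ?p t)))"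
    unfolding circ_norm_def
  proof (rule integral_le[OF int])
    show "(\<lambda>t. real m * (\<Sum>i<m. (cmod (c i))\<^sup>2 * ((cmod (poly (F i) (cis t)))\<^sup>2 / ?p t))) integrable_on {0..2*pi}"
      using has by blast
    fix t :: real
    have "(cmod (poly (\<Sum>i<m. smult (c i) (F i)) (cis t)))\<^sup>2 \<le> (\<Sum>i<m. cmod (c i) * cmod (poly (F i) (cis t)))\<^sup>2"
      by (intro power_mono) (auto simp: poly_sum norm_mult intro: order_trans[OF norm_sum])
    also have "\<dots> \<le> real m * (\<Sum>i<m. (cmod (c i) * cmod (poly (F i) (cis t)))\<^sup>2)"
      using sum_squared_le_sum_of_squares[of "\<lambda>i. cmod (c i) * cmod (poly (F i) (cis t))" "{..<m}"]
      by (simp add: mult.commute)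
    finally have "(cmod (poly (\<Sum>i<m. smult (c i) (F i)) (cis t)))\<^sup>2 / ?p t
      \<le> real m * (\<Sum>i<m. (cmod (c i) * cmod (poly (F i) (cis t)))\<^sup>2) / ?p t"
      by (rule divide_right_mono) simp
    then show "(cmod (poly (\<Sum>i<m. smult (c i) (F i)) (cis t)))\<^sup>2 / ?p t
      \<le> real m * (\<Sum>i<m. (cmod (c i))\<^sup>2 * ((cmod (poly (F i) (cis t)))\<^sup>2 / ?p t))"
      by (simp add: power_mult_distrib flip: sum_divide_distrib)
  qed
  also have "\<dots> = real m * (\<Sum>i<m. (cmod (c i))\<^sup>2 * circ_norm (F i) P)"
    using has by (rule integral_unique)
  finally show ?thesis .
qed

lemma eval2_smult: "eval2 (smult c P) w z = poly c w * eval2 P w z"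
  by (simp add: eval2_conv_poly_poly)

lemma eval2_sum: "eval2 (\<Sum>i\<in>A. f i) w z = (\<Sum>i\<in>A. eval2 (f i) w z)"
  by (induction A rule: infinite_finite_induct) (simp_all add: eval2_add)

text \<open>The left side is the slice norm of the determinant D(z1) seen as a polynomial constant
  in z2. Since D is a combination of the \<open>E i\<close> with coefficients in C[z1], the bounds
  for the \<open>E i\<close> carry over.\<close>

lemma circ_norm_det_bounded:
  assumes ss: "semi_stable P" and m: "m \<ge> 1"
    and E: "\<And>i. i < m \<Longrightarrow> E i \<in> Ip P" "\<And>i. i < m \<Longrightarrow> degree (E i) < m"
  obtains C W where "W \<noteq> 0" "\<And>w. cmod w = 1 \<Longrightarrow> poly W w \<noteq> 0 \<Longrightarrow>
    (cmod (poly (detN m (E2mat E)) w))\<^sup>2 * circ_norm 1 (slice w P) \<le> C"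
proof -
  define D where "D = detN m (E2mat E)"
  \<comment> \<open>Column 0 belongs to the power z2^0: its cofactors cancel all positive powers of
    z2 and leave D itself. The degree bound guarantees that the m columns hold all coefficients of
    the entries.\<close>
  obtain c where c: "\<And>j. j < m \<Longrightarrow> (\<Sum>i<m. c i * E2mat E i j) = (if j = 0 then D else 0)"
    using detN_row_combination[of 0 m "E2mat E"] m unfolding D_def by auto
  have D: "(\<Sum>i<m. [:c i:] * E i) = [:D:]"
  proof (rule poly_eqI)
    fix k
    show "coeff (\<Sum>i<m. [:c i:] * E i) k = coeff [:D:] k"
    proof (cases "k < m")
      case True
      then show ?thesis using c[OF True] by (simp add: coeff_sum E2mat_def coeff_pCons split: nat.split)
    next
      case False
      then have "coeff (E i) k = 0" if "i < m" for i using E(2)[OF that] by (intro coeff_eq_0) auto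
      then show ?thesis using False m by (simp add: coeff_sum coeff_pCons split: nat.split)
    qed
  qed
  have "\<exists>C W. W \<noteq> 0 \<and> (\<forall>w. cmod w = 1 \<longrightarrow> poly W w \<noteq> 0 \<longrightarrow> circ_norm (slice w (E i)) (slice w P) \<le> C)"
    if "i < m" for i
    using Ip_imp_circ_norm_bounded[OF ss E(1)[OF that]] by metis
  then obtain CE WE where CE: "\<And>i. i < m \<Longrightarrow> WE i \<noteq> 0"
    "\<And>i w. i < m \<Longrightarrow> cmod w = 1 \<Longrightarrow> poly (WE i) w \<noteq> 0 \<Longrightarrow> circ_norm (slice w (E i)) (slice w P) \<le> CE i"
    by metis
  have "\<exists>K>0. \<forall>w. cmod w = 1 \<longrightarrow> (cmod (poly (c i) w))\<^sup>2 \<le> K" for i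
    by (rule bounded_on_circle[of "\<lambda>w. (cmod (poly (c i) w))\<^sup>2"]) (auto intro!: continuous_intros)
  then obtain K where K: "\<And>i. K i > 0" "\<And>i w. cmod w = 1 \<Longrightarrow> (cmod (poly (c i) w))\<^sup>2 \<le> K i" by metis
  obtain R where R: "R \<noteq> 0"
    and nz: "\<And>w z. cmod w = 1 \<Longrightarrow> poly R w \<noteq> 0 \<Longrightarrow> cmod z \<le> 1 \<Longrightarrow> eval2 P w z \<noteq> 0"
    by (rule semi_stable_bezout[OF ss]) blast
  show ?thesis
  proof (rule that)
    show "R * (\<Prod>i<m. WE i) \<noteq> 0" using R CE(1) by auto
    fix w assume w: "cmod w = 1" "poly (R * (\<Prod>i<m. WE i)) w \<noteq> 0"
    have nz': "poly (slice w P) (cis t) \<noteq> 0" for t using nz[OF w(1), of "cis t"] w(2) by (simp add: poly_slice)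
    have WE: "poly (WE i) w \<noteq> 0" if "i < m" for i using w(2) that by (auto simp: poly_prod)
    have sl: "poly (slice w [:D:]) z = poly (\<Sum>i<m. smult (poly (c i) w) (slice w (E i))) z" for z
      unfolding D[symmetric] by (simp add: poly_slice eval2_sum eval2_smult poly_sum)
    have "(cmod (poly D w))\<^sup>2 * circ_norm 1 (slice w P) = circ_norm (slice w [:D:]) (slice w P)"
      unfolding circ_norm_def integral_mult_right[symmetric] by (simp add: poly_slice)
    also have "\<dots> = circ_norm (\<Sum>i<m. smult (poly (c i) w) (slice w (E i))) (slice w P)"
      unfolding circ_norm_def sl ..
    also have "\<dots> \<le> real m * (\<Sum>i<m. (cmod (poly (c i) w))\<^sup>2 * circ_norm (slice w (E i)) (slice w P))"
      by (rule circ_norm_sum_le[OF nz'])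
    also have "\<dots> \<le> real m * (\<Sum>i<m. K i * CE i)"
      using w(1) WE K CE(2) by (intro mult_left_mono sum_mono mult_mono) (auto simp: circ_norm_nonneg less_imp_le)
    finally show "(cmod (poly (detN m (E2mat E)) w))\<^sup>2 * circ_norm 1 (slice w P) \<le> real m * (\<Sum>i<m. K i * CE i)"
      unfolding D_def .
  qed
qed

section \<open>Assembling the bound on the torus\<close>

lemma T_factor_le:
  assumes "T_factor h f"
  obtains K where "K > 0" "\<And>w. cmod w = 1 \<Longrightarrow> cmod (poly h w) \<le> K * cmod (poly f w)"
proof -
  obtain g where g: "f = g * h" "\<And>z. cmod z = 1 \<Longrightarrow> poly g z \<noteq> 0"
    using assms unfolding T_factor_def by blast
  have "continuous_on (sphere 0 1) (\<lambda>w. inverse (cmod (poly g w)))"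
    using g(2) by (intro continuous_intros) auto
  then obtain K where K: "K > 0" "\<And>w. cmod w = 1 \<Longrightarrow> inverse (cmod (poly g w)) \<le> K"
    using bounded_on_circle by blast
  have "cmod (poly h w) \<le> K * cmod (poly f w)" if w: "cmod w = 1" for w
  proof -
    have "cmod (poly h w) = inverse (cmod (poly g w)) * cmod (poly f w)"
      using g(2)[OF w] unfolding g(1) by (simp add: norm_mult)
    also have "\<dots> \<le> K * cmod (poly f w)" using K(2)[OF w] by (rule mult_right_mono) simp
    finally show ?thesis .
  qed
  with K(1) show ?thesis by (rule that)
qed

text \<open>Each of the finitely many excluded points of the circle is a one-sided limit of
  admissible ones.\<close>

lemma le_on_circle_by_density:
  fixes f g :: "complex \<Rightarrow> real"
  assumes "continuous_on UNIV f" "continuous_on UNIV g" "W \<noteq> 0"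
    and le: "\<And>w. cmod w = 1 \<Longrightarrow> poly W w \<noteq> 0 \<Longrightarrow> f w \<le> g w" and w: "cmod w = 1"
  shows "f w \<le> g w"
proof -
  obtain s where s: "w = cis s" using w complex_norm_eq_1_exp_eq[of w] by (metis cis_conv_exp)
  have "continuous_on UNIV (\<lambda>s. f (cis s))"
    by (rule continuous_on_compose2[OF assms(1)]) (auto intro: continuous_intros)
  moreover have "continuous_on UNIV (\<lambda>s. g (cis s))"
    by (rule continuous_on_compose2[OF assms(2)]) (auto intro: continuous_intros)
  ultimately have "((\<lambda>s. f (cis s)) \<longlongrightarrow> f (cis s)) (at_right s)" "((\<lambda>s. g (cis s)) \<longlongrightarrow> g (cis s)) (at_right s)"
    unfolding continuous_on_def by (auto intro: tendsto_within_subset)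
  moreover have "eventually (\<lambda>s. f (cis s) \<le> g (cis s)) (at_right s)"
    using eventually_at_right_poly_cis_nonzero[OF assms(3)] by eventually_elim (rule le, auto)
  ultimately show ?thesis unfolding s by (intro tendsto_le[of "at_right s"]) auto
qed

theorem theorem8p1:
  fixes p :: "complex poly poly" and n m :: nat and g h :: "complex poly"
    and E1 E2 :: "nat \<Rightarrow> complex poly poly"
  assumes "semi_stable p" and "deg1 p = n" and "degree p = m" and "n \<ge> 1" and "m \<ge> 1"
    and "onb p (E1space p) n E1" and "onb p (E2space p) m E2"
    and "T_factor g (detN n (E1mat E1))" and "T_factor h (detN m (E2mat E2))"
  shows "(\<lambda>q. in_z2 g * in_z1 h * q) ` Ip p \<subseteq> Ip_inf p"
proof
  fix Q assume "Q \<in> (\<lambda>q. in_z2 g * in_z1 h * q) ` Ip p"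
  then obtain q where q: "q \<in> Ip p" and Q: "Q = in_z2 g * in_z1 h * q" by blast
  note ss = assms(1)
  define D where "D = detN m (E2mat E2)"
  have E2: "E2 i \<in> Ip p" "degree (E2 i) < m" if "i < m" for i
  proof -
    have "E2 i \<in> Pset p n (m - 1)"
      using assms that unfolding onb_def E2space_def ocompl_def by blast
    then show "E2 i \<in> Ip p" "degree (E2 i) < m" using assms(5) unfolding Pset_def by auto
  qed
  obtain C1 W1 where 1: "W1 \<noteq> 0" "\<And>w. cmod w = 1 \<Longrightarrow> poly W1 w \<noteq> 0 \<Longrightarrow> circ_norm (slice w q) (slice w p) \<le> C1"
    by (rule Ip_imp_circ_norm_bounded[OF ss q]) blast
  obtain C2 W2 where 2: "W2 \<noteq> 0" "\<And>w. cmod w = 1 \<Longrightarrow> poly W2 w \<noteq> 0 \<Longrightarrow>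
      (cmod (poly D w))\<^sup>2 * circ_norm 1 (slice w p) \<le> C2"
    unfolding D_def by (rule circ_norm_det_bounded[OF ss assms(5) E2]) blast+
  obtain R where R: "R \<noteq> 0"
    and nz: "\<And>w z. cmod w = 1 \<Longrightarrow> poly R w \<noteq> 0 \<Longrightarrow> cmod z \<le> 1 \<Longrightarrow> eval2 p w z \<noteq> 0"
    by (rule semi_stable_bezout[OF ss]) blast
  have "continuous_on (sphere 0 1) (\<lambda>w. lip_bound m (slice w p))"
    unfolding lip_bound_def coeff_slice by (intro continuous_intros)
  then obtain L where L: "L > 0" "\<And>w. cmod w = 1 \<Longrightarrow> lip_bound m (slice w p) \<le> L"
    using bounded_on_circle by blast
  have "continuous_on (sphere 0 1) (\<lambda>w. cmod (poly g w))" by (intro continuous_intros)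
  then obtain Kg where Kg: "Kg > 0" "\<And>z. cmod z = 1 \<Longrightarrow> cmod (poly g z) \<le> Kg"
    using bounded_on_circle by blast
  obtain Kh where Kh: "Kh > 0" "\<And>w. cmod w = 1 \<Longrightarrow> cmod (poly h w) \<le> Kh * cmod (poly D w)"
    using T_factor_le[OF assms(9)] unfolding D_def by blast
  define N where "N = degree q"
  define c where "c = 4 ^ (N + 1 + 2 * m) * (real N + 1) ^ 3 * L\<^sup>2"
  have c: "c \<ge> 0" unfolding c_def by simp
  \<comment> \<open>Stated without division by p and without slice norms, so that both sides are
    continuous in w and the inequality can be extended to the zeros of R * W1 * W2.\<close>
  have bound: "(cmod (poly h w) * cmod (eval2 q w (cis t)))\<^sup>2 \<le> Kh\<^sup>2 * (c * (C1 * C2)) * (cmod (eval2 p w (cis t)))\<^sup>2"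
    if t: "t \<in> {0..2*pi}" and w: "cmod w = 1" "poly (R * W1 * W2) w \<noteq> 0" for w t
  proof -
    let ?q = "cmod (eval2 q w (cis t))" and ?p = "cmod (eval2 p w (cis t))"
    have "?q\<^sup>2 \<le> c * (circ_norm (slice w q) (slice w p) * circ_norm 1 (slice w p)) * ?p\<^sup>2"
      unfolding c_def poly_slice[symmetric]
    proof (rule cmod_poly_le_circ_norms[OF _ _ L(2)[OF w(1)] _ t])
      show "degree (slice w p) \<le> m" "degree (slice w q) \<le> N"
        using degree_slice_le assms(3) unfolding N_def by auto
      show "poly (slice w p) (cis t) \<noteq> 0" for t using nz[OF w(1), of "cis t"] w(2) by (simp add: poly_slice)
    qed
    then have "(cmod (poly D w))\<^sup>2 * ?q\<^sup>2
       \<le> (cmod (poly D w))\<^sup>2 * (c * (circ_norm (slice w q) (slice w p) * circ_norm 1 (slice w p)) * ?p\<^sup>2)"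
      by (rule mult_left_mono) simp
    also have "\<dots> = c * (circ_norm (slice w q) (slice w p) * ((cmod (poly D w))\<^sup>2 * circ_norm 1 (slice w p))) * ?p\<^sup>2"
      by (simp only: mult_ac)
    also have "\<dots> \<le> c * (C1 * C2) * ?p\<^sup>2"
    proof (intro mult_right_mono mult_left_mono mult_mono c)
      show le: "circ_norm (slice w q) (slice w p) \<le> C1" using 1(2) w by simp
      show "0 \<le> C1" using circ_norm_nonneg le by (rule order_trans)
      show "(cmod (poly D w))\<^sup>2 * circ_norm 1 (slice w p) \<le> C2" using 2(2) w by simp
    qed (simp_all add: circ_norm_nonneg)
    finally have D: "(cmod (poly D w))\<^sup>2 * ?q\<^sup>2 \<le> c * (C1 * C2) * ?p\<^sup>2" .
    have "(cmod (poly h w) * ?q)\<^sup>2 \<le> (Kh * cmod (poly D w) * ?q)\<^sup>2"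
      using Kh(2)[OF w(1)] by (intro power_mono mult_right_mono) auto
    also have "\<dots> = Kh\<^sup>2 * ((cmod (poly D w))\<^sup>2 * ?q\<^sup>2)" by (simp add: power_mult_distrib)
    also have "\<dots> \<le> Kh\<^sup>2 * (c * (C1 * C2) * ?p\<^sup>2)" using D by (rule mult_left_mono) simp
    finally show ?thesis by (simp add: mult.assoc)
  qed
  have bound': "(cmod (poly h w) * cmod (eval2 q w (cis t)))\<^sup>2 \<le> Kh\<^sup>2 * (c * (C1 * C2)) * (cmod (eval2 p w (cis t)))\<^sup>2"
    if t: "t \<in> {0..2*pi}" and w: "cmod w = 1" for w t
    by (rule le_on_circle_by_density[of _ _ "R * W1 * W2", OF _ _ _ bound[OF t] w])
      (use R 1(1) 2(1) in \<open>auto intro!: continuous_intros\<close>)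
  define B where "B = Kg * sqrt (Kh\<^sup>2 * (c * (C1 * C2)))"
  \<comment> \<open>The absolute value spares a sign argument for C1 * C2: \<open>sqrt\<close> is
    odd and multiplicative on all reals, so B is defined whatever that sign is.\<close>
  have "cmod (quot_torus Q p x) \<le> \<bar>B\<bar>" if x: "x \<in> {0..2*pi} \<times> {0..2*pi}" for x
  proof -
    obtain s t where st: "x = (s, t)" "t \<in> {0..2*pi}" using x by auto
    let ?p = "cmod (eval2 p (cis s) (cis t))"
    have "cmod (poly h (cis s)) * cmod (eval2 q (cis s) (cis t)) \<le> sqrt (Kh\<^sup>2 * (c * (C1 * C2)) * ?p\<^sup>2)"
      using bound'[OF st(2), of "cis s"] by (intro real_le_rsqrt) auto
    also have "\<dots> = sqrt (Kh\<^sup>2 * (c * (C1 * C2))) * ?p" by (simp only: real_sqrt_mult real_sqrt_abs abs_norm_cancel)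
    finally have "cmod (poly g (cis t)) * (cmod (poly h (cis s)) * cmod (eval2 q (cis s) (cis t)))
        \<le> Kg * (sqrt (Kh\<^sup>2 * (c * (C1 * C2))) * ?p)"
      by (intro mult_mono[OF Kg(2)]) (use Kg(1) in auto)
    then have "cmod (eval2 Q (cis s) (cis t)) \<le> B * ?p"
      unfolding Q B_def by (simp add: eval2_mult eval2_in_z1 eval2_in_z2 norm_mult mult.assoc)
    also have "\<dots> \<le> \<bar>B\<bar> * ?p" by (rule mult_right_mono) auto
    \<comment> \<open>At a zero of p on the torus the quotient is 0 by the convention x / 0 = 0, so
      the bound holds at every point and not merely almost everywhere.\<close>
    finally show ?thesis unfolding st(1) quot_torus_def
      by (cases "?p = 0") (simp_all add: norm_divide divide_le_eq)
  qed
  then have "AE x in torus. cmod (quot_torus Q p x) \<le> \<bar>B\<bar>"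
    by (intro AE_I2) (simp add: torus_def)
  moreover have "quot_torus Q p \<in> borel_measurable torus"
    unfolding torus_def using borel_measurable_quot_torus
    by (intro measurable_restrict_space1 measurable_completion) simp
  ultimately show "Q \<in> Ip_inf p" unfolding Ip_inf_def Linf_torus_def by blast
qed

end
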